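(* Let $\Omega$ be an h-convex domain in $\mathbb{H}$ and $f\in USC(\Omega)$. Assume that there exists an h-quasiconvex function $\underline{f}\in USC(\Omega)$ such that $f\ge\underline{f}$ in $\Omega$. Let $u_0=f$ and, for $n=1,2,\ldots$, let $u_n\in USC(\Omega)$ be iteratively defined by $u_n=v_n^*$ in $\Omega$, where $v_n^*$ denotes the upper semicontinuous envelope of the function $$v_n(p)=\sup\{u(p):\ u\in USC(\Omega)\text{ is a subsolution of }u+H(p,u,\nabla_Hu)=u_{n-1}\text{ in }\Omega\},\quad p\in\Omega.$$ Then $u_n\to Q(f)$ pointwise in $\Omega$ as $n\to\infty$, where $Q(f)\in USC(\Omega)$ is the h-quasiconvex envelope of $f$.
   Context: The Heisenberg group $\mathbb{H}$ is $\mathbb{R}^3$ (with its usual topology) with the group law $(x_p,y_p,z_p)\cdot(x_q,y_q,z_q)=(x_p+x_q,\,y_p+y_q,\,z_p+z_q+\frac12(x_py_q-x_qy_p))$. Let $\mathbb{H}_0=\{(x,y,0):x,y\in\mathbb{R}\}$ and, for $p\in\mathbb{H}$, $\mathbb{H}_p=\{p\cdot h:h\in\mathbb{H}_0\}$. For $q\in\mathbb{H}_p$, $[p,q]$ denotes the horizontal segment joining $p$ and $q$ (the straight segment from $p$ to $q$). For $\zeta=(x,y,z)\in\mathbb{H}$ write $\zeta_h=(x,y)$. With $X_1=\partial_x-\frac y2\partial_z$ and $X_2=\partial_y+\frac x2\partial_z$, the horizontal gradient is $\nabla_H\varphi=(X_1\varphi,X_2\varphi)$. A domain is a connected open set. $USC(\Omega)$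 denotes the upper semicontinuous functions on $\Omega$. A set $E\subset\mathbb{H}$ is h-convex if $[p,q]\subset E$ for every $p\in E$ and $q\in\mathbb{H}_p\cap E$. For $\Omega$ h-convex, $u:\Omega\to\mathbb{R}$ is h-quasiconvex if $u(w)\le\max\{u(p),u(q)\}$ for all $p\in\Omega$, $q\in\mathbb{H}_p\cap\Omega$, $w\in[p,q]$. The h-quasiconvex envelope of $f$ in $\Omega$ is $Q(f)(p)=\sup\{g(p): g\le f\text{ in }\Omega,\ g\text{ h-quasiconvex in }\Omega\}$, with the convention $\sup\emptyset=-\infty$. For $u:\Omega\to\mathbb{R}$ and $p\in\Omega$ put $S_p(u)=\{\xi\in\mathbb{H}_p\cap\Omega:u(\xi)<u(p)\}$. For subsolutions, the nonlocal Hamiltonian is $H(p,u(p),\nabla_Hu(p))=\sup\{\langle\nabla_Hu(p),(p^{-1}\cdot\xi)_h\rangle:\xi\in S_p(u)\}$, understood in the following viscosity sense. For $g\in USC(\Omega)$ locally bounded in $\Omega$, a subsolution of $u+H(p,u,\nabla_Hu)=g$ in $\Omega$ is a locally bounded upper semicontinuous function $u:\Omega\to\mathbb{R}$ such that whenever $p\in\Omega$ and $\varphi\in C^1(\Omega)$ are such that $u-\varphi$ attains a maximum at $p$, one has $u(p)+\sup\{\langle\nabla_H\varphi(p),(p^{-1}\cdot\xi)_h\rangle:\xi\in S_p(u)\}\le g(p)$, the supremum being taken as $0$ if $\nabla_H\varphi(p)=0$. *)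

theory Defs
  imports "HOL-Analysis.Analysis"
begin

section \<open>The Heisenberg group\<close>

type_synonym heis = "real \<times> real \<times> real"

fun hmult :: "heis \<Rightarrow> heis \<Rightarrow> heis"  (infixl "\<cdot>\<^sub>H" 70) where
  "(x\<^sub>p, y\<^sub>p, z\<^sub>p) \<cdot>\<^sub>H (x\<^sub>q, y\<^sub>q, z\<^sub>q) =
     (x\<^sub>p + x\<^sub>q, y\<^sub>p + y\<^sub>q, z\<^sub>p + z\<^sub>q + 1/2 * (x\<^sub>p * y\<^sub>q - x\<^sub>q * y\<^sub>p))"

fun hinv :: "heis \<Rightarrow> heis" where
  "hinv (x, y, z) = (- x, - y, - z)"

lemma hmult_hinv: "hinv p \<cdot>\<^sub>H p = (0, 0, 0)" "p \<cdot>\<^sub>H hinv p = (0, 0, 0)"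
  by (cases p; simp)+

fun hpart :: "heis \<Rightarrow> real \<times> real" where
  "hpart (x, y, z) = (x, y)"

definition hplane0 :: "heis set" where
  "hplane0 = {(x, y, 0) | x y. True}"

definition hplane :: "heis \<Rightarrow> heis set" where
  "hplane p = {p \<cdot>\<^sub>H h | h. h \<in> hplane0}"

fun X1 :: "(heis \<Rightarrow> real) \<Rightarrow> heis \<Rightarrow> real" where
  "X1 \<phi> (x, y, z) = deriv (\<lambda>t. \<phi> (t, y, z)) x - y / 2 * deriv (\<lambda>t. \<phi> (x, y, t)) z"

fun X2 :: "(heis \<Rightarrow> real) \<Rightarrow> heis \<Rightarrow> real" where
  "X2 \<phi> (x, y, z) = deriv (\<lambda>t. \<phi> (x, t, z)) y + x / 2 * deriv (\<lambda>t. \<phi> (x, y, t)) z"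

definition hgrad :: "(heis \<Rightarrow> real) \<Rightarrow> heis \<Rightarrow> real \<times> real" where
  "hgrad \<phi> p = (X1 \<phi> p, X2 \<phi> p)"

section \<open>h-convex sets, h-quasiconvex functions and the envelope\<close>

text \<open>For \<open>q \<in> hplane p\<close> the horizontal segment is \<open>closed_segment p q\<close>.\<close>

definition h_convex :: "heis set \<Rightarrow> bool" where
  "h_convex E \<longleftrightarrow> (\<forall>p\<in>E. \<forall>q\<in>hplane p \<inter> E. closed_segment p q \<subseteq> E)"

definition h_quasiconvex_on :: "heis set \<Rightarrow> (heis \<Rightarrow> real) \<Rightarrow> bool" where
  "h_quasiconvex_on \<Omega> u \<longleftrightarrow>
     (\<forall>p\<in>\<Omega>. \<forall>q\<in>hplane p \<inter> \<Omega>. \<forall>w\<in>closed_segment p q. u w \<le> max (u p) (u q))"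

text \<open>Extended real valued, so that the supremum of the empty set is \<open>- \<infinity>\<close>.\<close>

definition hq_envelope :: "heis set \<Rightarrow> (heis \<Rightarrow> real) \<Rightarrow> heis \<Rightarrow> ereal" where
  "hq_envelope \<Omega> f p =
     (SUP g \<in> {g. h_quasiconvex_on \<Omega> g \<and> (\<forall>q\<in>\<Omega>. g q \<le> f q)}. ereal (g p))"

section \<open>Semicontinuity\<close>

definition usc_on :: "'a::topological_space set \<Rightarrow> ('a \<Rightarrow> 'b::linorder) \<Rightarrow> bool" where
  "usc_on \<Omega> u \<longleftrightarrow> (\<forall>p\<in>\<Omega>. \<forall>c. u p < c \<longrightarrow> (\<forall>\<^sub>F q in at p within \<Omega>. u q < c))"

text \<open>\<open>limsup\<close> of \<open>v q\<close> as \<open>q \<rightarrow> p\<close> within \<open>\<Omega>\<close>, the value \<open>q = p\<close> being allowed.\<close>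

definition usc_env :: "'a::metric_space set \<Rightarrow> ('a \<Rightarrow> ereal) \<Rightarrow> 'a \<Rightarrow> ereal" where
  "usc_env \<Omega> v p = (INF r \<in> {0<..}. SUP q \<in> ball p r \<inter> \<Omega>. v q)"

definition locally_bounded_on :: "'a::metric_space set \<Rightarrow> ('a \<Rightarrow> real) \<Rightarrow> bool" where
  "locally_bounded_on \<Omega> u \<longleftrightarrow> (\<forall>p\<in>\<Omega>. \<exists>r>0. bounded (u ` (ball p r \<inter> \<Omega>)))"

section \<open>The nonlocal equation\<close>

definition C1_on :: "heis set \<Rightarrow> (heis \<Rightarrow> real) \<Rightarrow> bool" where
  "C1_on \<Omega> \<phi> \<longleftrightarrow>
     (\<exists>D :: heis \<Rightarrow> heis \<Rightarrow>\<^sub>L real.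
        (\<forall>p\<in>\<Omega>. (\<phi> has_derivative blinfun_apply (D p)) (at p)) \<and> continuous_on \<Omega> D)"

definition strict_sublevel :: "heis set \<Rightarrow> (heis \<Rightarrow> real) \<Rightarrow> heis \<Rightarrow> heis set" where
  "strict_sublevel \<Omega> u p = {\<xi> \<in> hplane p \<inter> \<Omega>. u \<xi> < u p}"

text \<open>
  The Hamiltonian at \<open>p\<close> with the gradient of \<open>u\<close> replaced by \<open>\<eta>\<close>.  The supremum may be \<open>\<infinity>\<close>,
  since the sublevel set need not be bounded.
\<close>

definition hamiltonian :: "heis set \<Rightarrow> (heis \<Rightarrow> real) \<Rightarrow> heis \<Rightarrow> real \<times> real \<Rightarrow> ereal" where
  "hamiltonian \<Omega> u p \<eta> =
     (if \<eta> = 0 then 0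
      else SUP \<xi> \<in> strict_sublevel \<Omega> u p. ereal (\<eta> \<bullet> hpart (hinv p \<cdot>\<^sub>H \<xi>)))"

definition subsolution :: "heis set \<Rightarrow> (heis \<Rightarrow> real) \<Rightarrow> (heis \<Rightarrow> real) \<Rightarrow> bool" where
  "subsolution \<Omega> g u \<longleftrightarrow>
     usc_on \<Omega> u \<and> locally_bounded_on \<Omega> u \<and>
     (\<forall>p\<in>\<Omega>. \<forall>\<phi>. C1_on \<Omega> \<phi> \<and> (\<forall>q\<in>\<Omega>. u q - \<phi> q \<le> u p - \<phi> p) \<longrightarrow>
        ereal (u p) + hamiltonian \<Omega> u p (hgrad \<phi> p) \<le> ereal (g p))"

definition sup_subsolutions :: "heis set \<Rightarrow> (heis \<Rightarrow> real) \<Rightarrow> heis \<Rightarrow> ereal" where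
  "sup_subsolutions \<Omega> g p = (SUP u \<in> {u. subsolution \<Omega> g u}. ereal (u p))"

text \<open>
  \<open>u\<close> is the sequence of real valued upper semicontinuous functions generated from \<open>f\<close>.  If at some
  stage there is no subsolution, the supremum is \<open>- \<infinity>\<close> and no such sequence exists.
  Local boundedness of every \<open>u n\<close>, which the equation with right-hand side \<open>u n\<close> presupposes, is
  not listed because it is automatic: \<open>u n\<close> lies above a subsolution, which is locally bounded.
\<close>

definition hq_iteration :: "heis set \<Rightarrow> (heis \<Rightarrow> real) \<Rightarrow> (nat \<Rightarrow> heis \<Rightarrow> real) \<Rightarrow> bool" where
  "hq_iteration \<Omega> f u \<longleftrightarrow>
     (\<forall>p\<in>\<Omega>. u 0 p = f p) \<and>
     (\<forall>n. usc_on \<Omega> (u (Suc n)) \<and>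
          (\<forall>p\<in>\<Omega>. ereal (u (Suc n) p) = usc_env \<Omega> (sup_subsolutions \<Omega> (u n)) p))"

end

theory Submission
  imports Defs
begin

text \<open>
  Every subsolution with right-hand side \<open>u\<^sub>n\<close> lies below \<open>u\<^sub>n\<close>, so the iteration decreases. If \<open>w\<close> is a
  subsolution for \<open>u\<^sub>n\<close> and \<open>E\<close> is h-quasiconvex with \<open>E \<le> u\<^sub>n\<close>, then \<open>max w E\<close> is again a subsolution; hence
  the iteration stays above \<open>E = Q(f)\<close>, and it suffices that its limit \<open>U\<close> is h-quasiconvex.

  If it is not, then on a horizontal segment from \<open>p\<close> to \<open>q\<close> some value of \<open>U\<close> exceeds a number \<open>c\<close> that is
  larger than \<open>U p\<close> and \<open>U q\<close>. In a thin tube around the segment use the test function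
  \<open>\<phi> = \<epsilon> S + K (I\<^sup>2 + J\<^sup>2)\<close>, where \<open>S\<close> is the time along the horizontal flow in the direction of the
  segment and \<open>I\<close>, \<open>J\<close> are flow invariants vanishing on the segment. Where \<open>w - \<phi>\<close> is maximal in the tube
  (with value above \<open>c\<close>), following the flow leads to a point near \<open>q\<close> where \<open>w < c\<close>, and the
  derivative of \<open>\<phi>\<close> along the flow is \<open>\<epsilon>\<close>. So the Hamiltonian is bounded below by a fixed \<open>\<theta> > 0\<close>, and
  a bound \<open>u\<^sub>n \<le> \<phi> + B\<close> in the tube improves to \<open>u\<^sub>n\<^sub>+\<^sub>1 \<le> \<phi> + max (B - \<theta>) c\<close>. Iterating gives
  \<open>U \<le> \<phi> + c\<close>, a contradiction for small \<open>\<epsilon>\<close>. This works with the individual subsolutions, so that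
  neither Perron's method nor stability of viscosity solutions is needed.
\<close>

section \<open>Continuously differentiable majorants\<close>

text \<open>Gradient vectors replace the operator-valued derivative, so that continuity of the
  derivative is continuity of a map into the space itself and the product and chain rules become
  vector identities.\<close>

lemma C1_onI:
  assumes "\<And>p. p \<in> S \<Longrightarrow> (\<phi> has_derivative (\<lambda>h. G p \<bullet> h)) (at p)" "continuous_on S G"
  shows "C1_on S \<phi>"
  unfolding C1_on_def
proof (intro exI conjI ballI)
  show "continuous_on S (\<lambda>p. blinfun_inner_right (G p))"
    by (intro bounded_linear.continuous_on[OF bounded_linear_blinfun_inner_right] assms)
qed (use assms in simp)

lemma C1_onE:
  assumes "C1_on S \<phi>"
  obtains G where "\<And>p. p \<in> S \<Longrightarrow> (\<phi> has_derivative (\<lambda>h. G p \<bullet> h)) (at p)" "continuous_on S G"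
proof -
  obtain D where D: "\<And>p. p \<in> S \<Longrightarrow> (\<phi> has_derivative blinfun_apply (D p)) (at p)" "continuous_on S D"
    using assms unfolding C1_on_def by blast
  \<comment> \<open>The gradient is assembled from the partial derivatives, the values of
    \<open>D p\<close> on the basis vectors.\<close>
  define G where "G p = (\<Sum>b\<in>Basis. blinfun_apply (D p) b *\<^sub>R b)" for p
  have "blinfun_apply (D p) h = G p \<bullet> h" for p h
  proof -
    have "blinfun_apply (D p) h = blinfun_apply (D p) (\<Sum>b\<in>Basis. (h \<bullet> b) *\<^sub>R b)"
      by (simp add: euclidean_representation)
    also have "\<dots> = (\<Sum>b\<in>Basis. (h \<bullet> b) * blinfun_apply (D p) b)"
      by (simp only: blinfun.sum_right blinfun.scaleR_right real_scaleR_def)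
    also have "\<dots> = G p \<bullet> h"
      by (simp add: G_def inner_sum_right inner_commute[of "\<Sum>b\<in>Basis. _ b"] inner_commute mult.commute)
    finally show ?thesis .
  qed
  then have "blinfun_apply (D p) = (\<lambda>h. G p \<bullet> h)" for p by (simp only: fun_eq_iff) simp
  then have "(\<phi> has_derivative (\<lambda>h. G p \<bullet> h)) (at p)" if "p \<in> S" for p using D(1)[OF that] by simp
  moreover have "continuous_on S G"
    unfolding G_def by (intro continuous_intros D)
  ultimately show ?thesis using that by blast
qed

section \<open>Closure properties of C^1 functions\<close>

lemma C1_on_subset: "C1_on T \<phi> \<Longrightarrow> S \<subseteq> T \<Longrightarrow> C1_on S \<phi>"
  unfolding C1_on_def by (meson continuous_on_subset in_mono)

lemma C1_on_imp_continuous_on: "C1_on S \<phi> \<Longrightarrow> continuous_on S \<phi>"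
  unfolding C1_on_def
  by (meson continuous_at_imp_continuous_on has_derivative_continuous)

lemma C1_on_linear: "bounded_linear l \<Longrightarrow> C1_on S l"
  unfolding C1_on_def
  by (rule exI[of _ "\<lambda>_. Blinfun l"])
     (simp add: bounded_linear_Blinfun_apply bounded_linear_imp_has_derivative)

lemma C1_on_const: "C1_on S (\<lambda>_. c)"
  by (rule C1_onI[of _ _ "\<lambda>_. 0"]) auto

lemma C1_on_add:
  assumes "C1_on S \<phi>" "C1_on S \<psi>"
  shows "C1_on S (\<lambda>p. \<phi> p + \<psi> p)"
proof -
  obtain F where F: "\<And>p. p \<in> S \<Longrightarrow> (\<phi> has_derivative (\<lambda>h. F p \<bullet> h)) (at p)" "continuous_on S F"
    using C1_onE[OF assms(1)] by blast
  obtain G where G: "\<And>p. p \<in> S \<Longrightarrow> (\<psi> has_derivative (\<lambda>h. G p \<bullet> h)) (at p)" "continuous_on S G"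
    using C1_onE[OF assms(2)] by blast
  show ?thesis
  proof (rule C1_onI[of _ _ "\<lambda>p. F p + G p"])
    fix p assume "p \<in> S"
    then show "((\<lambda>p. \<phi> p + \<psi> p) has_derivative (\<lambda>h. (F p + G p) \<bullet> h)) (at p)"
      using has_derivative_add[OF F(1) G(1)] by (simp add: inner_add_left)
  qed (intro continuous_intros F G)
qed

lemma C1_on_mult:
  assumes "C1_on S \<phi>" "C1_on S \<psi>"
  shows "C1_on S (\<lambda>p. \<phi> p * \<psi> p)"
proof -
  obtain F where F: "\<And>p. p \<in> S \<Longrightarrow> (\<phi> has_derivative (\<lambda>h. F p \<bullet> h)) (at p)" "continuous_on S F"
    using C1_onE[OF assms(1)] by blast
  obtain G where G: "\<And>p. p \<in> S \<Longrightarrow> (\<psi> has_derivative (\<lambda>h. G p \<bullet> h)) (at p)" "continuous_on S G"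
    using C1_onE[OF assms(2)] by blast
  show ?thesis
  proof (rule C1_onI[of _ _ "\<lambda>p. \<psi> p *\<^sub>R F p + \<phi> p *\<^sub>R G p"])
    fix p assume "p \<in> S"
    then show "((\<lambda>p. \<phi> p * \<psi> p) has_derivative (\<lambda>h. (\<psi> p *\<^sub>R F p + \<phi> p *\<^sub>R G p) \<bullet> h)) (at p)"
      using has_derivative_mult[OF F(1) G(1)] by (simp add: inner_add_left algebra_simps)
  qed (intro continuous_intros F G C1_on_imp_continuous_on assms)
qed

lemma C1_on_diff: "C1_on S \<phi> \<Longrightarrow> C1_on S \<psi> \<Longrightarrow> C1_on S (\<lambda>p. \<phi> p - \<psi> p)"
  using C1_on_add[of S \<phi> "\<lambda>p. (- 1) * \<psi> p"] C1_on_mult[of S "\<lambda>_. - 1" \<psi>] C1_on_const by simp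

lemma C1_on_power2: "C1_on S \<phi> \<Longrightarrow> C1_on S (\<lambda>p. (\<phi> p)\<^sup>2)"
  by (simp add: power2_eq_square C1_on_mult)

lemma C1_on_fst: "C1_on S (\<lambda>p. fst p)"
  and C1_on_fst_snd: "C1_on S (\<lambda>p. fst (snd p))"
  and C1_on_snd_snd: "C1_on S (\<lambda>p. snd (snd p))"
  by (intro C1_on_linear bounded_linear_intros)+

lemma C1_on_inner_diff: "C1_on S (\<lambda>q. (q - p) \<bullet> (q - p))"
  by (rule C1_onI[of _ _ "\<lambda>q. 2 *\<^sub>R (q - p)"])
     (auto intro!: derivative_eq_intros continuous_on_scaleR continuous_on_const continuous_on_id
        continuous_on_diff simp: inner_commute)

lemma C1_on_compose:
  assumes "C1_on S \<phi>" and h: "\<And>p. p \<in> S \<Longrightarrow> (h has_real_derivative h' (\<phi> p)) (at (\<phi> p))"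
    and "continuous_on (\<phi> ` S) h'"
  shows "C1_on S (\<lambda>p. h (\<phi> p))"
proof -
  obtain F where F: "\<And>p. p \<in> S \<Longrightarrow> (\<phi> has_derivative (\<lambda>h. F p \<bullet> h)) (at p)" "continuous_on S F"
    using C1_onE[OF assms(1)] by blast
  show ?thesis
  proof (rule C1_onI[of _ _ "\<lambda>p. h' (\<phi> p) *\<^sub>R F p"])
    fix p assume "p \<in> S"
    then have "((\<lambda>p. h (\<phi> p)) has_derivative (\<lambda>x. h' (\<phi> p) * (F p \<bullet> x))) (at p)"
      using has_derivative_compose[OF F(1)] h[unfolded has_field_derivative_def] by blast
    then show "((\<lambda>p. h (\<phi> p)) has_derivative (\<lambda>x. h' (\<phi> p) *\<^sub>R F p \<bullet> x)) (at p)" by simp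
  next
    show "continuous_on S (\<lambda>p. h' (\<phi> p) *\<^sub>R F p)"
      by (intro continuous_intros F continuous_on_compose2[OF assms(3)] C1_on_imp_continuous_on assms) auto
  qed
qed

section \<open>Growth functions and bump functions of class C^1\<close>

lemma has_real_derivative_pos_part_square:
  "((\<lambda>t. (max 0 t)\<^sup>2) has_real_derivative 2 * max 0 t) (at t)"
proof -
  consider "t < 0" | "t = 0" | "t > 0" by linarith
  then show ?thesis
  proof cases
    case 1
    have "((\<lambda>t. 0) has_real_derivative 2 * max 0 t) (at t)" using 1 by simp
    then show ?thesis
      by (rule has_field_derivative_transform_within_open[of _ _ _ "{..<0}"]) (use 1 in auto)
  next
    case 3
    have "((\<lambda>t. t\<^sup>2) has_real_derivative 2 * max 0 t) (at t)"
      using 3 by (auto intro!: derivative_eq_intros)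
    then show ?thesis
      by (rule has_field_derivative_transform_within_open[of _ _ _ "{0<..}"]) (use 3 in auto)
  next
    case 2
    \<comment> \<open>This is the difference quotient at 0; its second factor is 0 or 1, so it is
      bounded by \<open>\<bar>h\<bar>\<close>.\<close>
    have "((\<lambda>h. max 0 h * (max 0 h / h)) \<longlongrightarrow> 0) (at (0::real))"
    proof (rule Lim_null_comparison)
      show "\<forall>\<^sub>F h in at (0::real). norm (max 0 h * (max 0 h / h)) \<le> \<bar>h\<bar>"
        by (intro always_eventually) (auto simp: max_def)
    qed (auto intro!: tendsto_eq_intros)
    then show ?thesis using 2 by (simp add: has_field_derivative_iff power2_eq_square)
  qed
qed

text \<open>Take \<open>h\<close> to be the sum over all n of \<open>c n\<close> times the squared
  positive part of \<open>t - n\<close>. Below any bound on t only finitely many terms are nonzero,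
  and from \<open>t = n + 1\<close> on the n-th term alone is at least \<open>c n\<close>.\<close>

lemma exists_C1_real_majorant:
  fixes M :: "nat \<Rightarrow> real"
  obtains h h' where "\<And>t. (h has_real_derivative h' t) (at t)" "continuous_on UNIV h'"
    "\<And>t. 0 \<le> h t" "\<And>t n. real n + 1 \<le> t \<Longrightarrow> M n \<le> h t"
proof -
  define c where "c n = max 0 (M n)" for n
  define k where "k N t = (\<Sum>n<N. c n * (max 0 (t - real n))\<^sup>2)" for N t
  define k' where "k' N t = (\<Sum>n<N. c n * (2 * max 0 (t - real n)))" for N t
  define h where "h t = k (nat \<lceil>t\<rceil>) t" for t
  define h' where "h' t = k' (nat \<lceil>t\<rceil>) t" for t
  \<comment> \<open>For \<open>t < N\<close> the terms from the ceiling of t up to N vanish. Hence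
    \<open>h\<close> agrees on a whole open half-line with the finite sum \<open>k N\<close>, which
    can be differentiated.\<close>
  have ceil: "nat \<lceil>t\<rceil> \<le> N" "\<And>n. n \<ge> nat \<lceil>t\<rceil> \<Longrightarrow> t \<le> real n" if "t < real N" for t N
    using that by (auto simp: nat_le_iff ceiling_le_iff)
  have hk: "h t = k N t" if "t < real N" for t N
    unfolding h_def k_def
    by (rule sum.mono_neutral_left) (use ceil[OF that] in \<open>auto simp: max_def not_less\<close>)
  have hk': "h' t = k' N t" if "t < real N" for t N
    unfolding h'_def k'_def
    by (rule sum.mono_neutral_left) (use ceil[OF that] in \<open>auto simp: max_def not_less\<close>)
  have dk: "(k N has_real_derivative k' N t) (at t)" for N t
  proof -
    have "((\<lambda>t. (max 0 (t - real n))\<^sup>2) has_real_derivative 2 * max 0 (t - real n) * 1) (at t)" for n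
      by (rule DERIV_chain2[OF has_real_derivative_pos_part_square]) (auto intro!: derivative_eq_intros)
    then show ?thesis unfolding k_def k'_def
      by (intro DERIV_sum DERIV_cmult) simp
  qed
  show ?thesis
  proof
    fix t :: real
    obtain N :: nat where N: "t < real N" using reals_Archimedean2 by blast
    show "(h has_real_derivative h' t) (at t)"
      unfolding hk'[OF N]
      by (rule has_field_derivative_transform_within_open[OF dk, of "{..<real N}"]) (use N hk in auto)
    show "0 \<le> h t" unfolding h_def k_def c_def by (auto intro!: sum_nonneg)
  next
    have "continuous_on {..<real N} h'" for N
    proof -
      have "continuous_on {..<real N} (k' N)" unfolding k'_def by (intro continuous_intros)
      then show ?thesis using hk' by (subst continuous_on_cong[OF refl, of _ _ "k' N"]) auto
    qed
    then show "continuous_on UNIV h'"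
      by (metis UNIV_I continuous_at_imp_continuous_on continuous_on_eq_continuous_at lessThan_iff
          open_lessThan reals_Archimedean2)
  next
    fix t n assume t: "real n + 1 \<le> t"
    have "M n \<le> c n * 1" by (simp add: c_def)
    also have "\<dots> \<le> c n * (max 0 (t - real n))\<^sup>2"
      using t by (intro mult_left_mono) (auto simp: c_def)
    also have "\<dots> \<le> h t" unfolding h_def k_def
      using t by (intro member_le_sum[where f = "\<lambda>n. c n * (max 0 (t - real n))\<^sup>2"])
        (auto simp: c_def, linarith)
    finally show "M n \<le> h t" .
  qed
qed

text \<open>Cover \<open>\<Omega>\<close> by countably many balls inside it and add bumps, each
  positive exactly on one ball, with weights \<open>(1/2)^k\<close>. Radii at most 1 bound the bumps
  and their gradients uniformly, so the series may be differentiated term by term.\<close>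

lemma exists_C1_positive_exactly_on:
  assumes "open \<Omega>"
  obtains s where "C1_on UNIV s" "\<And>p. p \<in> \<Omega> \<Longrightarrow> 0 < s p" "\<And>p. p \<notin> \<Omega> \<Longrightarrow> s p = 0"
proof (cases "\<Omega> = {}")
  case True
  then show ?thesis using that[of "\<lambda>_. 0"] C1_on_const by auto
next
  case False
  define \<F> where "\<F> = {ball x r | x r. 0 < r \<and> r \<le> 1 \<and> ball x r \<subseteq> \<Omega>}"
  have Un\<F>: "\<Union>\<F> = \<Omega>"
  proof
    show "\<Omega> \<subseteq> \<Union>\<F>"
    proof
      fix x assume "x \<in> \<Omega>"
      then obtain r where "r > 0" "ball x r \<subseteq> \<Omega>" using assms openE by blast
      moreover have "ball x (min r 1) \<subseteq> ball x r" by (rule subset_ball) simp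
      ultimately have "ball x (min r 1) \<in> \<F>" unfolding \<F>_def
        by (intro CollectI exI[of _ x] exI[of _ "min r 1"]) auto
      moreover have "x \<in> ball x (min r 1)" using \<open>r > 0\<close> by simp
      ultimately show "x \<in> \<Union>\<F>" by blast
    qed
  qed (auto simp: \<F>_def)
  have "open S" if "S \<in> \<F>" for S using that by (auto simp: \<F>_def)
  then obtain \<F>' where \<F>': "\<F>' \<subseteq> \<F>" "countable \<F>'" "\<Union>\<F>' = \<Union>\<F>"
    using Lindelof[of \<F>] by metis
  have "\<F>' \<noteq> {}" using False Un\<F> \<F>'(3) by force
  define B where "B = from_nat_into \<F>'"
  have B: "range B = \<F>'" unfolding B_def by (rule range_from_nat_into[OF \<open>\<F>' \<noteq> {}\<close> \<F>'(2)])
  have "\<exists>x r. B k = ball x r \<and> 0 < r \<and> r \<le> 1 \<and> ball x r \<subseteq> \<Omega>" for k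
  proof -
    have "B k \<in> \<F>" using B \<F>'(1) by blast
    then show ?thesis unfolding \<F>_def by (simp only: mem_Collect_eq)
  qed
  then obtain c r where cr: "\<And>k. B k = ball (c k) (r k)" "\<And>k. 0 < r k" "\<And>k. r k \<le> 1"
    "\<And>k. ball (c k) (r k) \<subseteq> \<Omega>" by metis
  \<comment> \<open>\<open>q k\<close> is positive exactly on the k-th ball, \<open>b k\<close> is
    the weighted bump and \<open>G k\<close> its gradient.\<close>
  define q where "q k p = (r k)\<^sup>2 - (p - c k) \<bullet> (p - c k)" for k p
  define b where "b k p = (1/2)^k * (max 0 (q k p))\<^sup>2" for k p
  define G where "G k p = ((1/2)^k * (- 4 * max 0 (q k p))) *\<^sub>R (p - c k)" for k p
  have q_pos: "q k p > 0 \<longleftrightarrow> p \<in> ball (c k) (r k)" for k p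
  proof -
    have "q k p = (r k)\<^sup>2 - (dist (c k) p)\<^sup>2"
      by (simp add: q_def dist_norm power2_norm_eq_inner norm_minus_commute[of "c k"])
    then have "q k p > 0 \<longleftrightarrow> (dist (c k) p)\<^sup>2 < (r k)\<^sup>2" by linarith
    then show ?thesis using cr(2)[of k] using power2_less_imp_less[of "dist (c k) p" "r k"] power_strict_mono[of "dist (c k) p" "r k" 2] by auto
  qed
  have q_le: "q k p \<le> 1" for k p
  proof -
    have "(r k)\<^sup>2 \<le> 1" using cr(2,3)[of k] by (simp add: power_le_one)
    then show ?thesis unfolding q_def using inner_ge_zero[of "p - c k"] by linarith
  qed
  have b_le: "norm (b k p) \<le> (1/2)^k" for k p
  proof -
    have "(max 0 (q k p))\<^sup>2 \<le> 1" using q_le[of k p] by (intro power_le_one) auto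
    then have "(1/2)^k * (max 0 (q k p))\<^sup>2 \<le> (1/2)^k" by (intro mult_left_le) auto
    then show ?thesis by (simp add: b_def abs_mult)
  qed
  have G_le: "norm (G k p) \<le> 4 * (1/2)^k" for k p
  proof (cases "p \<in> ball (c k) (r k)")
    case True
    then have "norm (p - c k) \<le> 1" "max 0 (q k p) \<le> 1" using cr(3)[of k] q_le[of k p]
      by (auto simp: dist_norm norm_minus_commute)
    then have "max 0 (q k p) * norm (p - c k) \<le> 1" by (intro mult_le_one) auto
    then have "(4 * (1/2)^k) * (max 0 (q k p) * norm (p - c k)) \<le> (4 * (1/2)^k)"
      by (intro mult_left_le) auto
    then show ?thesis by (simp add: G_def abs_mult mult_ac)
  next
    case False
    then have "max 0 (q k p) = 0" using q_pos[of k p] by linarith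
    then show ?thesis by (simp add: G_def)
  qed
  have bd: "(b k has_derivative (\<lambda>h. G k p \<bullet> h)) (at p)" for k p
  proof -
    have "(q k has_derivative (\<lambda>h. - 2 * ((p - c k) \<bullet> h))) (at p)"
      unfolding q_def by (auto intro!: derivative_eq_intros simp: inner_commute)
    from has_derivative_compose[OF this has_real_derivative_pos_part_square[unfolded has_field_derivative_def]]
    have "((\<lambda>x. (max 0 (q k x))\<^sup>2) has_derivative (\<lambda>h. 2 * max 0 (q k p) * (- 2 * ((p - c k) \<bullet> h)))) (at p)" .
    from has_derivative_mult_right[OF this, of "(1/2)^k"]
    show ?thesis unfolding b_def G_def by (simp add: mult_ac)
  qed
  have Gc: "continuous_on UNIV (G k)" for k
    unfolding G_def q_def by (intro continuous_intros)
  define g where "g p = (\<Sum>k. G k p)" for p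
  have "summable (\<lambda>k. 4 * (1/2)^k :: real)" by (intro summable_mult summable_geometric) simp
  then have unif: "uniform_limit UNIV (\<lambda>n p. \<Sum>k<n. G k p) g sequentially"
    unfolding g_def by (intro Weierstrass_m_test[of _ _ "\<lambda>k. 4 * (1/2)^k"] G_le)
  have gc: "continuous_on UNIV g"
    by (rule uniform_limit_theorem[OF _ unif]) (intro always_eventually allI continuous_intros Gc, simp)
  have bs: "summable (\<lambda>k. b k p)" for p
    by (rule summable_comparison_test'[of "\<lambda>k. (1/2)^k" 0]) (use b_le in \<open>simp_all add: summable_geometric\<close>)
  have "\<exists>s. \<forall>p\<in>UNIV. (\<lambda>k. b k p) sums (s p) \<and> (s has_derivative (\<lambda>h. g p \<bullet> h)) (at p within UNIV)"
  proof (rule has_derivative_series[of UNIV b "\<lambda>k p h. G k p \<bullet> h" _ 0 "suminf (\<lambda>k. b k 0)"])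
    fix e :: real assume "e > 0"
    from uniform_limitD[OF unif this]
    show "\<forall>\<^sub>F n in sequentially. \<forall>x\<in>UNIV. \<forall>h. norm ((\<Sum>i<n. G i x \<bullet> h) - g x \<bullet> h) \<le> e * norm h"
    proof eventually_elim
      case (elim n)
      show ?case
      proof (intro ballI allI)
        fix x h
        have "norm ((\<Sum>i<n. G i x \<bullet> h) - g x \<bullet> h) = \<bar>((\<Sum>i<n. G i x) - g x) \<bullet> h\<bar>"
          by (simp add: inner_diff_left inner_sum_left)
        also have "\<dots> \<le> norm ((\<Sum>i<n. G i x) - g x) * norm h" by (rule Cauchy_Schwarz_ineq2)
        also have "\<dots> \<le> e * norm h"
          using bspec[OF elim, of x] by (intro mult_right_mono) (simp_all only: dist_norm less_imp_le UNIV_I norm_ge_zero)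
        finally show "norm ((\<Sum>i<n. G i x \<bullet> h) - g x \<bullet> h) \<le> e * norm h" .
      qed
    qed
  qed (use bd summable_sums[OF bs] in auto)
  then obtain s where s: "\<And>p. (\<lambda>k. b k p) sums (s p)" "\<And>p. (s has_derivative (\<lambda>h. g p \<bullet> h)) (at p)"
    by (simp only: UNIV_I ball_simps) blast
  have b_nonneg: "b k p \<ge> 0" for k p by (simp add: b_def)
  show ?thesis
  proof
    show "C1_on UNIV s" by (rule C1_onI[OF s(2) gc])
  next
    fix p assume "p \<in> \<Omega>"
    then obtain k where "p \<in> B k" using B \<F>'(3) Un\<F> by blast
    then have "q k p > 0" using cr(1) q_pos by blast
    then have "b k p > 0" by (simp add: b_def)
    then show "0 < s p"
      using suminf_pos2[OF bs b_nonneg] sums_unique[OF s(1)[of p]] by simp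
  next
    fix p assume "p \<notin> \<Omega>"
    then have "max 0 (q k p) = 0" for k using q_pos[of k p] cr(4)[of k] by force
    then have "b k p = 0" for k by (simp add: b_def)
    then have "(\<lambda>k. b k p) sums 0" by (simp only: sums_zero)
    then show "s p = 0" by (rule sums_unique2[OF s(1)])
  qed
qed

text \<open>With \<open>s\<close> positive exactly on \<open>\<Omega>\<close>, the function \<open>1 + (1 / s p + p \<bullet> p)\<close> is a proper \<open>C\<^sup>1\<close>
  exhaustion of \<open>\<Omega>\<close>; compose it with a sufficiently fast growing function of one variable.\<close>

lemma exists_C1_majorant:
  assumes "open \<Omega>" and bdd: "\<And>K. compact K \<Longrightarrow> K \<subseteq> \<Omega> \<Longrightarrow> bdd_above (m ` K)"
  obtains \<Psi> where "C1_on \<Omega> \<Psi>" "\<And>p. p \<in> \<Omega> \<Longrightarrow> 0 \<le> \<Psi> p" "\<And>p. p \<in> \<Omega> \<Longrightarrow> m p \<le> \<Psi> p"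
proof -
  obtain s where s: "C1_on UNIV s" "\<And>p. p \<in> \<Omega> \<Longrightarrow> 0 < s p" "\<And>p. p \<notin> \<Omega> \<Longrightarrow> s p = 0"
    by (rule exists_C1_positive_exactly_on[OF assms(1)]) (rule that)
  define e where "e p = 1 + (1 / s p + p \<bullet> p)" for p
  have e_C1: "C1_on \<Omega> e"
  proof -
    have "C1_on \<Omega> (\<lambda>p. 1 / s p)"
    proof (rule C1_on_compose[OF C1_on_subset[OF s(1) subset_UNIV], where h' = "\<lambda>t. - (1 / t^2)"])
      fix p assume "p \<in> \<Omega>"
      then have "s p \<noteq> 0" using s(2)[of p] by linarith
      then show "((/) 1 has_real_derivative - (1 / (s p)\<^sup>2)) (at (s p))"
        by (auto intro!: derivative_eq_intros simp: power2_eq_square)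
    next
      show "continuous_on (s ` \<Omega>) (\<lambda>t. - (1 / t\<^sup>2))"
        using s(2) by (intro continuous_intros) force
    qed
    moreover have "C1_on \<Omega> (\<lambda>p. p \<bullet> p)" using C1_on_inner_diff[of \<Omega> 0] by simp
    ultimately show ?thesis unfolding e_def by (intro C1_on_add C1_on_const)
  qed
  have "\<exists>M. \<forall>p\<in>\<Omega>. e p \<le> t \<longrightarrow> m p \<le> M" for t
  proof (cases "t > 0")
    case True
    \<comment> \<open>\<open>K\<close> contains the sublevel set of \<open>e\<close> at height t. It
      is closed because \<open>s\<close> is continuous on the whole space, and it stays inside
      \<open>\<Omega>\<close> because \<open>s\<close> vanishes outside.\<close>
    define K where "K = {p. 1 / t \<le> s p} \<inter> {p. p \<bullet> p \<le> t}"
    have "K \<subseteq> cball 0 (sqrt t)" unfolding K_def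
      by (auto simp: norm_eq_sqrt_inner)
    then have "bounded K" using bounded_subset by blast
    moreover have "closed K" unfolding K_def
      by (intro closed_Int closed_Collect_le continuous_intros C1_on_imp_continuous_on s)
    ultimately have "compact K" by (simp add: compact_eq_bounded_closed)
    moreover have "K \<subseteq> \<Omega>"
    proof
      fix p assume "p \<in> K"
      then have "1 / t \<le> s p" unfolding K_def by blast
      moreover have "0 < 1 / t" using True by simp
      ultimately show "p \<in> \<Omega>" using s(3)[of p] by linarith
    qed
    ultimately have "bdd_above (m ` K)" by (rule bdd)
    then obtain M where M: "\<forall>x\<in>m ` K. x \<le> M" unfolding bdd_above_def by blast
    have "p \<in> K" if "p \<in> \<Omega>" "e p \<le> t" for p
    proof -
      have "0 < 1 / s p" using s(2)[OF that(1)] by simp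
      then have "1 / s p \<le> t" "p \<bullet> p \<le> t"
        using that(2) inner_ge_zero[of p] unfolding e_def by linarith+
      then show ?thesis using True s(2)[OF that(1)] by (simp add: K_def field_simps)
    qed
    then show ?thesis using M by blast
  next
    case False
    have "\<not> e p \<le> t" if "p \<in> \<Omega>" for p
    proof -
      have "0 < 1 / s p" using s(2)[OF that] by simp
      then show ?thesis using False inner_ge_zero[of p] unfolding e_def by linarith
    qed
    then show ?thesis by blast
  qed
  then have "\<forall>n::nat. \<exists>M. \<forall>p\<in>\<Omega>. e p \<le> real n + 2 \<longrightarrow> m p \<le> M" by blast
  then obtain M where M: "\<And>n p. p \<in> \<Omega> \<Longrightarrow> e p \<le> real n + 2 \<Longrightarrow> m p \<le> M n" by metis
  obtain h h' where h: "\<And>t. (h has_real_derivative h' t) (at t)" "continuous_on UNIV h'"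
    "\<And>t. 0 \<le> h t" "\<And>t n. real n + 1 \<le> t \<Longrightarrow> M n \<le> h t"
    by (rule exists_C1_real_majorant[of M]) (rule that)
  show ?thesis
  proof
    show "C1_on \<Omega> (\<lambda>p. h (e p))"
      by (rule C1_on_compose[OF e_C1 h(1)]) (rule continuous_on_subset[OF h(2) subset_UNIV])
    show "0 \<le> h (e p)" for p by (rule h(3))
  next
    fix p assume p: "p \<in> \<Omega>"
    have "e p \<ge> 1" using s(2)[OF p] by (simp add: e_def)
    \<comment> \<open>The bound \<open>e p \<ge> 1\<close> makes n a natural number. The shift by
      one puts \<open>e p\<close> between \<open>n + 1\<close>, where \<open>h\<close> has reached
      \<open>M n\<close>, and \<open>n + 2\<close>, up to which \<open>M n\<close> bounds
      \<open>m\<close>.\<close>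
    define n where "n = nat (\<lfloor>e p\<rfloor> - 1)"
    have "real n = of_int \<lfloor>e p\<rfloor> - 1" using \<open>e p \<ge> 1\<close> by (simp add: n_def)
    then have n: "real n + 1 \<le> e p" "e p \<le> real n + 2" by linarith+
    show "m p \<le> h (e p)" using M[OF p n(2)] h(4)[OF n(1)] by linarith
  qed
qed

section \<open>Horizontal lines and semicontinuity\<close>

text \<open>\<open>hvec p v\<close> is the value at \<open>p\<close> of the left-invariant field \<open>v\<^sub>1 X\<^sub>1 + v\<^sub>2 X\<^sub>2\<close>, and \<open>hline p v\<close> is
  the integral curve of that field through \<open>p\<close>, which is a straight line.\<close>

definition hline :: "heis \<Rightarrow> real \<times> real \<Rightarrow> real \<Rightarrow> heis" where
  "hline p v t = p \<cdot>\<^sub>H (t * fst v, t * snd v, 0)"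

definition hvec :: "heis \<Rightarrow> real \<times> real \<Rightarrow> heis" where
  "hvec p v = (fst v, snd v, (fst p * snd v - fst (snd p) * fst v) / 2)"

lemma hline_eq: "hline p v t = p + t *\<^sub>R hvec p v"
  by (cases p) (simp add: hline_def hvec_def field_simps)

lemma hline_0 [simp]: "hline p v 0 = p"
  by (simp add: hline_eq)

text \<open>Both increments are multiples of \<open>v\<close>, so the antisymmetric term in the
  group law vanishes and the times add.\<close>

lemma hline_hline: "hline (hline p v s) v t = hline p v (s + t)"
  by (cases p) (simp add: hline_def algebra_simps)

lemma hline_in_hplane: "hline p v t \<in> hplane p"
  unfolding hplane_def hplane0_def hline_def by blast

lemma hplaneE:
  assumes "q \<in> hplane p"
  obtains v where "q = hline p v 1"
proof -
  obtain x y where "q = p \<cdot>\<^sub>H (x, y, 0)" using assms unfolding hplane_def hplane0_def by blast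
  then have "q = hline p (x, y) 1" by (simp add: hline_def)
  then show ?thesis by (rule that)
qed

text \<open>Turns the inner product in the Hamiltonian into t times the slope in direction
  \<open>v\<close>.\<close>

lemma hpart_hinv_hline: "hpart (hinv p \<cdot>\<^sub>H hline p v t) = t *\<^sub>R v"
  by (cases p, cases v) (simp add: hline_def)

lemma continuous_on_hline [continuous_intros]:
  assumes "continuous_on S f" "continuous_on S g"
  shows "continuous_on S (\<lambda>x. hline (f x) v (g x))"
  unfolding hline_eq hvec_def by (intro continuous_intros assms) auto

lemma hline_in_closed_segment:
  assumes "a \<le> c" "c \<le> b"
  shows "hline p v c \<in> closed_segment (hline p v a) (hline p v b)"
proof -
  have "c \<in> closed_segment a b" using assms by (simp add: closed_segment_eq_real_ivl)
  then obtain u where u: "0 \<le> u" "u \<le> 1" "c = (1 - u) * a + u * b"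
    unfolding in_segment by (simp only: real_scaleR_def) blast
  have "hline p v c = (1 - u) *\<^sub>R hline p v a + u *\<^sub>R hline p v b"
    unfolding hline_eq u(3) by (simp add: algebra_simps)
  with u show ?thesis unfolding in_segment by blast
qed

lemma closed_segment_hlineE:
  assumes "w \<in> closed_segment p (hline p v 1)"
  obtains s where "0 \<le> s" "s \<le> 1" "w = hline p v s"
proof -
  obtain u where u: "0 \<le> u" "u \<le> 1" "w = (1 - u) *\<^sub>R p + u *\<^sub>R hline p v 1"
    using assms unfolding in_segment by blast
  then have "w = hline p v u" by (simp add: hline_eq algebra_simps)
  with u show ?thesis using that by blast
qed

lemma h_quasiconvex_on_iff_hline:
  "h_quasiconvex_on \<Omega> u \<longleftrightarrow>
    (\<forall>p v s. p \<in> \<Omega> \<longrightarrow> hline p v 1 \<in> \<Omega> \<longrightarrow> 0 \<le> s \<longrightarrow> s \<le> 1 \<longrightarrow>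
      u (hline p v s) \<le> max (u p) (u (hline p v 1)))" (is "?L \<longleftrightarrow> ?R")
proof
  assume L: ?L
  show ?R
  proof (intro allI impI)
    fix p v and s :: real
    assume *: "p \<in> \<Omega>" "hline p v 1 \<in> \<Omega>" "0 \<le> s" "s \<le> 1"
    have "hline p v s \<in> closed_segment (hline p v 0) (hline p v 1)"
      using * by (intro hline_in_closed_segment)
    then show "u (hline p v s) \<le> max (u p) (u (hline p v 1))"
      using L * hline_in_hplane[of p v 1] unfolding h_quasiconvex_on_def hline_0 by blast
  qed
next
  assume R: ?R
  show ?L unfolding h_quasiconvex_on_def
  proof (intro ballI)
    fix p q w assume *: "p \<in> \<Omega>" "q \<in> hplane p \<inter> \<Omega>" "w \<in> closed_segment p q"
    then obtain v where q: "q = hline p v 1" using hplaneE by blast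
    with * obtain s where "0 \<le> s" "s \<le> 1" "w = hline p v s" using closed_segment_hlineE by blast
    then show "u w \<le> max (u p) (u q)" using R * q by blast
  qed
qed

text \<open>Any point of a horizontal line can serve as its base point, since the remaining points
  of the line lie in its horizontal plane.\<close>

lemma h_quasiconvex_onD:
  assumes "h_quasiconvex_on \<Omega> u" "hline p v a \<in> \<Omega>" "hline p v b \<in> \<Omega>" "a \<le> c" "c \<le> b"
  shows "u (hline p v c) \<le> max (u (hline p v a)) (u (hline p v b))"
proof -
  have "hline p v b \<in> hplane (hline p v a)"
    using hline_in_hplane[of "hline p v a" v "b - a"] by (simp add: hline_hline)
  then show ?thesis
    using assms hline_in_closed_segment[OF assms(4,5)] unfolding h_quasiconvex_on_def by blast
qed

lemma h_convexD:
  assumes "h_convex \<Omega>" "hline p v a \<in> \<Omega>" "hline p v b \<in> \<Omega>" "a \<le> c" "c \<le> b"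
  shows "hline p v c \<in> \<Omega>"
proof -
  have "hline p v b \<in> hplane (hline p v a)"
    using hline_in_hplane[of "hline p v a" v "b - a"] by (simp add: hline_hline)
  then show ?thesis
    using assms hline_in_closed_segment[OF assms(4,5)] unfolding h_convex_def by blast
qed

section \<open>The horizontal gradient and derivatives along horizontal lines\<close>

lemma hgrad_eq:
  assumes "(\<phi> has_derivative D) (at (x, y, z))"
  shows "hgrad \<phi> (x, y, z) = (D (1, 0, - y / 2), D (0, 1, x / 2))"
proof -
  have lin: "linear D" using assms has_derivative_linear by blast
  have 1: "((\<lambda>t. \<phi> (t, y, z)) has_real_derivative D (1, 0, 0)) (at x)"
  proof -
    have "((\<lambda>t. (t, y, z)) has_derivative (\<lambda>h. (h, 0, 0))) (at x)"
      by (intro has_derivative_Pair has_derivative_ident has_derivative_const)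
    from has_derivative_compose[OF this, of \<phi> D] assms
    have "((\<lambda>t. \<phi> (t, y, z)) has_derivative (\<lambda>h. D (h, 0, 0))) (at x)" by simp
    moreover have "(\<lambda>h. D (h, 0, 0)) = (*) (D (1, 0, 0))"
    proof
      show "D (h, 0, 0) = D (1, 0, 0) * h" for h using linear_scale[OF lin, of h "(1,0,0)"] by simp
    qed
    ultimately show ?thesis by (simp only: has_field_derivative_def)
  qed
  have 2: "((\<lambda>t. \<phi> (x, t, z)) has_real_derivative D (0, 1, 0)) (at y)"
  proof -
    have "((\<lambda>t. (x, t, z)) has_derivative (\<lambda>h. (0, h, 0))) (at y)"
      by (intro has_derivative_Pair has_derivative_ident has_derivative_const)
    from has_derivative_compose[OF this, of \<phi> D] assms
    have "((\<lambda>t. \<phi> (x, t, z)) has_derivative (\<lambda>h. D (0, h, 0))) (at y)" by simp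
    moreover have "(\<lambda>h. D (0, h, 0)) = (*) (D (0, 1, 0))"
    proof
      show "D (0, h, 0) = D (0, 1, 0) * h" for h using linear_scale[OF lin, of h "(0,1,0)"] by simp
    qed
    ultimately show ?thesis by (simp only: has_field_derivative_def)
  qed
  have 3: "((\<lambda>t. \<phi> (x, y, t)) has_real_derivative D (0, 0, 1)) (at z)"
  proof -
    have "((\<lambda>t. (x, y, t)) has_derivative (\<lambda>h. (0, 0, h))) (at z)"
      by (intro has_derivative_Pair has_derivative_ident has_derivative_const)
    from has_derivative_compose[OF this, of \<phi> D] assms
    have "((\<lambda>t. \<phi> (x, y, t)) has_derivative (\<lambda>h. D (0, 0, h))) (at z)" by simp
    moreover have "(\<lambda>h. D (0, 0, h)) = (*) (D (0, 0, 1))"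
    proof
      show "D (0, 0, h) = D (0, 0, 1) * h" for h using linear_scale[OF lin, of h "(0,0,1)"] by simp
    qed
    ultimately show ?thesis by (simp only: has_field_derivative_def)
  qed
  \<comment> \<open>By linearity the partial derivatives combine into the values of \<open>D\<close>
    on the left-invariant frame at \<open>(x, y, z)\<close>.\<close>
  have "D (1, 0, - y / 2) = D (1, 0, 0) - y / 2 * D (0, 0, 1)"
    using linear_add[OF lin, of "(1,0,0)" "(-y/2) *\<^sub>R (0,0,1)"] linear_scale[OF lin, of "-y/2" "(0,0,1)"]
    by simp
  moreover have "D (0, 1, x / 2) = D (0, 1, 0) + x / 2 * D (0, 0, 1)"
    using linear_add[OF lin, of "(0,1,0)" "(x/2) *\<^sub>R (0,0,1)"] linear_scale[OF lin, of "x/2" "(0,0,1)"]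
    by simp
  ultimately show ?thesis
    by (simp add: hgrad_def DERIV_imp_deriv[OF 1] DERIV_imp_deriv[OF 2] DERIV_imp_deriv[OF 3])
qed

lemma hgrad_cong:
  assumes "(\<phi> has_derivative D) (at p)" "(\<psi> has_derivative D) (at p)"
  shows "hgrad \<phi> p = hgrad \<psi> p"
  using assms by (cases p) (simp add: hgrad_eq)

text \<open>Chain rule: the velocity \<open>hvec p v\<close> has the coordinates of \<open>v\<close>
  in the left-invariant frame, on which \<open>hgrad\<close> evaluates the derivative.\<close>

lemma has_real_derivative_hline:
  assumes "(\<phi> has_derivative D) (at p)"
  shows "((\<lambda>t. \<phi> (hline p v t)) has_real_derivative hgrad \<phi> p \<bullet> v) (at 0)"
proof -
  obtain x y z where p: "p = (x, y, z)" by (cases p) auto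
  obtain a b where v: "v = (a, b)" by (cases v) auto
  have lin: "linear D" using assms has_derivative_linear by blast
  have "((\<lambda>t. hline p v t) has_derivative (\<lambda>h. h *\<^sub>R hvec p v)) (at 0)"
    unfolding hline_eq by (auto intro!: derivative_eq_intros)
  from has_derivative_compose[OF this, of \<phi> D] assms
  have "((\<lambda>t. \<phi> (hline p v t)) has_derivative (\<lambda>h. D (h *\<^sub>R hvec p v))) (at 0)" by simp
  moreover have "D (h *\<^sub>R hvec p v) = (hgrad \<phi> p \<bullet> v) * h" for h
  proof -
    have "hvec p v = a *\<^sub>R (1, 0, - y / 2) + b *\<^sub>R (0, 1, x / 2)"
      by (simp add: p v hvec_def field_simps)
    then have "D (hvec p v) = hgrad \<phi> p \<bullet> v"
      using hgrad_eq[OF assms[unfolded p]]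
      by (simp only: p v linear_add[OF lin] linear_scale[OF lin]) simp
    then show ?thesis by (simp add: linear_scale[OF lin])
  qed
  then have "(\<lambda>h. D (h *\<^sub>R hvec p v)) = (*) (hgrad \<phi> p \<bullet> v)" by (rule ext)
  ultimately show ?thesis by (simp only: has_field_derivative_def)
qed

lemma C1_on_has_real_derivative_hline:
  assumes "C1_on \<Omega> \<phi>" "p \<in> \<Omega>"
  shows "((\<lambda>t. \<phi> (hline p v t)) has_real_derivative hgrad \<phi> p \<bullet> v) (at 0)"
  using assms has_real_derivative_hline unfolding C1_on_def by blast

section \<open>Upper semicontinuity through open sublevel sets\<close>

lemma usc_on_iff_open_sublevel:
  assumes "open \<Omega>"
  shows "usc_on \<Omega> u \<longleftrightarrow> (\<forall>c. open {x \<in> \<Omega>. u x < c})"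
proof -
  have "usc_on \<Omega> u \<longleftrightarrow> (\<forall>c. \<forall>p\<in>{x \<in> \<Omega>. u x < c}. \<forall>\<^sub>F q in at p. q \<in> {x \<in> \<Omega>. u x < c})"
  proof -
    have "(\<forall>\<^sub>F q in at p within \<Omega>. u q < c) \<longleftrightarrow> (\<forall>\<^sub>F q in at p. q \<in> {x \<in> \<Omega>. u x < c})"
      if "p \<in> \<Omega>" for p c
    proof -
      have "\<forall>\<^sub>F q in at p. q \<in> \<Omega>" using assms that by (rule eventually_at_in_open')
      then show ?thesis unfolding at_within_open[OF that assms] mem_Collect_eq eventually_conj_iff
        by blast
    qed
    then show ?thesis unfolding usc_on_def by blast
  qed
  also have "\<dots> \<longleftrightarrow> (\<forall>c. open {x \<in> \<Omega>. u x < c})"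
  proof -
    have "open S \<longleftrightarrow> (\<forall>p\<in>S. \<forall>\<^sub>F q in at p. q \<in> S)" for S :: "'a set"
    proof -
      have "open S \<longleftrightarrow> (\<forall>p\<in>S. \<forall>\<^sub>F q in nhds p. q \<in> S)"
        unfolding open_subopen[of S] eventually_nhds subset_eq by (rule refl)
      then show ?thesis by (simp add: eventually_nhds_conv_at)
    qed
    then show ?thesis by blast
  qed
  finally show ?thesis .
qed

text \<open>Without a maximum the open sets where u lies below \<open>u q\<close>, for q in
  \<open>K\<close>, cover \<open>K\<close>. In a finite subcover the point q with the largest value
  is covered by none of them.\<close>

lemma usc_on_attains_max:
  fixes u :: "'a::topological_space \<Rightarrow> 'b::linorder"
  assumes "open \<Omega>" "usc_on \<Omega> u" "compact K" "K \<subseteq> \<Omega>" "K \<noteq> {}"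
  obtains p where "p \<in> K" "\<And>q. q \<in> K \<Longrightarrow> u q \<le> u p"
proof (rule ccontr)
  assume "\<not> thesis"
  with that have *: "\<exists>q\<in>K. u p < u q" if "p \<in> K" for p using \<open>p \<in> K\<close>
    by (meson not_le)
  have "\<And>q. q \<in> K \<Longrightarrow> open {x \<in> \<Omega>. u x < u q}"
    using usc_on_iff_open_sublevel[OF assms(1)] assms(2) by blast
  moreover have "K \<subseteq> (\<Union>q\<in>K. {x \<in> \<Omega>. u x < u q})" using * assms(4) by blast
  ultimately obtain C where C: "C \<subseteq> K" "finite C" "K \<subseteq> (\<Union>q\<in>C. {x \<in> \<Omega>. u x < u q})"
    using compactE_image[OF assms(3), of K "\<lambda>q. {x \<in> \<Omega>. u x < u q}"] by blast
  then have "C \<noteq> {}" using assms(5) by blast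
  then have "Max (u ` C) \<in> u ` C" using C(2) by (intro Max_in) auto
  then obtain q where q: "q \<in> C" "u q = Max (u ` C)" by auto
  then obtain r where "r \<in> C" "u q < u r" using C by blast
  then show False using q(2) C(2) by (metis Max_ge finite_imageI image_eqI leD)
qed

lemma usc_on_bdd_above_compact:
  fixes u :: "'a::topological_space \<Rightarrow> real"
  assumes "open \<Omega>" "usc_on \<Omega> u" "compact K" "K \<subseteq> \<Omega>"
  shows "bdd_above (u ` K)"
proof (cases "K = {}")
  case False
  obtain p where "p \<in> K" "\<And>q. q \<in> K \<Longrightarrow> u q \<le> u p"
    by (rule usc_on_attains_max[OF assms False]) (rule that)
  then show ?thesis by (intro bdd_aboveI2)
qed simp

lemma usc_on_diff_continuous:
  fixes u \<phi> :: "'a::topological_space \<Rightarrow> real"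
  assumes "usc_on \<Omega> u" "continuous_on \<Omega> \<phi>"
  shows "usc_on \<Omega> (\<lambda>x. u x - \<phi> x)"
  unfolding usc_on_def
proof (intro ballI allI impI)
  fix p c assume p: "p \<in> \<Omega>" and c: "u p - \<phi> p < c"
  define e where "e = (c - (u p - \<phi> p)) / 2"
  have "e > 0" using c by (simp add: e_def)
  have "\<forall>\<^sub>F q in at p within \<Omega>. u q < u p + e"
    using assms(1) p \<open>e > 0\<close> unfolding usc_on_def by (meson less_add_same_cancel1)
  moreover have "\<forall>\<^sub>F q in at p within \<Omega>. \<phi> p - e < \<phi> q"
    using assms(2) p \<open>e > 0\<close> unfolding continuous_on_def
    by (intro order_tendstoD(1)[of \<phi> "\<phi> p"]) auto
  ultimately show "\<forall>\<^sub>F q in at p within \<Omega>. u q - \<phi> q < c"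
    by eventually_elim (simp add: e_def field_simps)
qed

section \<open>Subsolutions\<close>

text \<open>The definition tests at maxima over all of \<open>\<Omega>\<close>. A local maximum at \<open>w\<close> becomes a global one when
  \<open>|q - w|\<^sup>2 \<Psi> q\<close> is added to the test function with \<open>\<Psi>\<close> large, and the gradient at \<open>w\<close> does not change.\<close>

lemma subsolution_local_test:
  assumes "open \<Omega>" and sub: "subsolution \<Omega> g u"
    and "w \<in> \<Omega>" "0 < \<rho>" and \<phi>: "C1_on \<Omega> \<phi>"
    and max: "\<And>q. q \<in> ball w \<rho> \<Longrightarrow> q \<in> \<Omega> \<Longrightarrow> u q - \<phi> q \<le> u w - \<phi> w"
  shows "ereal (u w) + hamiltonian \<Omega> u w (hgrad \<phi> w) \<le> ereal (g w)"
proof -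
  \<comment> \<open>Outside the ball the squared distance to \<open>w\<close> is at least
    \<open>\<rho>\<^sup>2\<close>, so a penalty factor of at least \<open>m\<close> absorbs all of
    the excess there.\<close>
  define m where "m q = (u q - (\<phi> q + (u w - \<phi> w))) / \<rho>\<^sup>2" for q
  have usc: "usc_on \<Omega> (\<lambda>q. u q - (\<phi> q + (u w - \<phi> w)))"
    using sub unfolding subsolution_def
    by (intro usc_on_diff_continuous continuous_on_add continuous_on_const C1_on_imp_continuous_on[OF \<phi>]) blast
  have "bdd_above (m ` K)" if K: "compact K" "K \<subseteq> \<Omega>" for K
  proof -
    obtain M where "\<forall>q\<in>K. u q - (\<phi> q + (u w - \<phi> w)) \<le> M"
      using usc_on_bdd_above_compact[OF assms(1) usc K] unfolding bdd_above_def by blast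
    then have "\<forall>q\<in>K. m q \<le> M / \<rho>\<^sup>2" unfolding m_def by (intro ballI divide_right_mono) simp_all
    then show ?thesis by (intro bdd_aboveI2) blast
  qed
  then obtain \<Psi> where \<Psi>: "C1_on \<Omega> \<Psi>" "\<And>q. q \<in> \<Omega> \<Longrightarrow> 0 \<le> \<Psi> q" "\<And>q. q \<in> \<Omega> \<Longrightarrow> m q \<le> \<Psi> q"
    by (rule exists_C1_majorant[OF assms(1), of m]) (assumption+, rule that)
  define \<psi> where "\<psi> q = \<phi> q + ((q - w) \<bullet> (q - w)) * \<Psi> q" for q
  have \<psi>: "C1_on \<Omega> \<psi>" unfolding \<psi>_def
    by (intro C1_on_add C1_on_mult C1_on_inner_diff \<phi> \<Psi>(1))
  have "u q - \<psi> q \<le> u w - \<psi> w" if "q \<in> \<Omega>" for q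
  proof (cases "q \<in> ball w \<rho>")
    case True
    have "0 \<le> ((q - w) \<bullet> (q - w)) * \<Psi> q" using \<Psi>(2)[OF that] by simp
    then show ?thesis using max[OF True that] by (simp add: \<psi>_def)
  next
    case False
    then have "\<rho> \<le> norm (q - w)" by (simp add: dist_norm norm_minus_commute)
    then have "\<rho>\<^sup>2 \<le> (q - w) \<bullet> (q - w)"
      using \<open>0 < \<rho>\<close> unfolding power2_norm_eq_inner[symmetric] by (intro power_mono) simp_all
    then have "\<rho>\<^sup>2 * \<Psi> q \<le> ((q - w) \<bullet> (q - w)) * \<Psi> q"
      using \<Psi>(2)[OF that] by (rule mult_right_mono)
    moreover have "\<rho>\<^sup>2 * m q \<le> \<rho>\<^sup>2 * \<Psi> q" using \<Psi>(3)[OF that] by (intro mult_left_mono) simp_all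
    moreover have "\<rho>\<^sup>2 * m q = u q - (\<phi> q + (u w - \<phi> w))" using \<open>0 < \<rho>\<close> by (simp add: m_def)
    ultimately show ?thesis by (simp add: \<psi>_def)
  qed
  then have "ereal (u w) + hamiltonian \<Omega> u w (hgrad \<psi> w) \<le> ereal (g w)"
    using sub \<psi> \<open>w \<in> \<Omega>\<close> unfolding subsolution_def by blast
  moreover have "hgrad \<psi> w = hgrad \<phi> w"
  proof -
    obtain F where F: "(\<phi> has_derivative F) (at w)"
      using \<phi> \<open>w \<in> \<Omega>\<close> unfolding C1_on_def by blast
    obtain G where G: "(\<Psi> has_derivative G) (at w)"
      using \<Psi>(1) \<open>w \<in> \<Omega>\<close> unfolding C1_on_def by blast
    have "((\<lambda>q. (q - w) \<bullet> (q - w)) has_derivative (\<lambda>h. 0)) (at w)"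
      by (auto intro!: derivative_eq_intros)
    from has_derivative_add[OF F has_derivative_mult[OF this G]]
    have "(\<psi> has_derivative F) (at w)" unfolding \<psi>_def by simp
    then show ?thesis using F by (rule hgrad_cong)
  qed
  ultimately show ?thesis by simp
qed

text \<open>The time t may have either sign: small negative times give the comparison with
  \<open>g\<close>, and a positive time up to the end of a segment gives the decrease of the
  iteration.\<close>

lemma hamiltonian_ge:
  assumes "\<eta> \<noteq> 0" "hline p v t \<in> \<Omega>" "u (hline p v t) < u p"
  shows "ereal (t * (\<eta> \<bullet> v)) \<le> hamiltonian \<Omega> u p \<eta>"
proof -
  have "hline p v t \<in> strict_sublevel \<Omega> u p"
    using assms hline_in_hplane unfolding strict_sublevel_def by blast
  then have "ereal (\<eta> \<bullet> hpart (hinv p \<cdot>\<^sub>H hline p v t)) \<le> hamiltonian \<Omega> u p \<eta>"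
    unfolding hamiltonian_def if_not_P[OF assms(1)] by (rule SUP_upper)
  then show ?thesis by (simp add: hpart_hinv_hline)
qed

lemma hline_in_open_nbhd:
  assumes "open \<Omega>" "hline p v s \<in> \<Omega>"
  obtains d where "0 < d" "\<And>t. \<bar>t - s\<bar> < d \<Longrightarrow> hline p v t \<in> \<Omega>"
proof -
  have "open (hline p v -` \<Omega>)"
    by (intro open_vimage assms continuous_on_hline[of UNIV "\<lambda>_. p" "\<lambda>t. t" v, simplified]) 
  then obtain d where "0 < d" "ball s d \<subseteq> hline p v -` \<Omega>" using assms(2) openE by blast
  then show ?thesis
    by (intro that[of d]) (simp_all add: dist_real_def abs_minus_commute subset_eq)
qed

text \<open>Moving from \<open>w\<close> against the horizontal gradient of the test function lowers \<open>u\<close>, so the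
  supremum in the Hamiltonian runs over points arbitrarily close to \<open>w\<close> and is at least \<open>0\<close>.\<close>

lemma subsolution_le_at_local_max:
  assumes "open \<Omega>" and sub: "subsolution \<Omega> g u"
    and "w \<in> \<Omega>" "0 < \<rho>" and \<phi>: "C1_on \<Omega> \<phi>"
    and max: "\<And>q. q \<in> ball w \<rho> \<Longrightarrow> q \<in> \<Omega> \<Longrightarrow> u q - \<phi> q \<le> u w - \<phi> w"
  shows "u w \<le> g w"
proof (rule ccontr)
  assume gu: "\<not> u w \<le> g w"
  define \<eta> where "\<eta> = hgrad \<phi> w"
  have le: "ereal (u w) + hamiltonian \<Omega> u w \<eta> \<le> ereal (g w)"
    unfolding \<eta>_def by (rule subsolution_local_test[OF assms])
  show False
  proof (cases "\<eta> = 0")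
    case True
    \<comment> \<open>For a vanishing gradient the Hamiltonian has its default value 0.\<close>
    then show False using le gu by (simp add: hamiltonian_def)
  next
    case False
    have der: "((\<lambda>t. \<phi> (hline w \<eta> t)) has_real_derivative \<eta> \<bullet> \<eta>) (at 0)"
      using C1_on_has_real_derivative_hline[OF \<phi> \<open>w \<in> \<Omega>\<close>, of \<eta>] by (simp only: \<eta>_def)
    have pos: "0 < \<eta> \<bullet> \<eta>" using False by simp
    obtain d where d: "0 < d" "\<And>h. 0 < h \<Longrightarrow> h < d \<Longrightarrow> \<phi> (hline w \<eta> (0 - h)) < \<phi> (hline w \<eta> 0)"
      using DERIV_pos_inc_left[OF der pos] by blast
    have "open (ball w \<rho> \<inter> \<Omega>)" "hline w \<eta> 0 \<in> ball w \<rho> \<inter> \<Omega>"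
      using assms(1,3,4) by (simp_all add: open_Int)
    then obtain d' where d': "0 < d'" "\<And>t. \<bar>t - 0\<bar> < d' \<Longrightarrow> hline w \<eta> t \<in> ball w \<rho> \<inter> \<Omega>"
      by (rule hline_in_open_nbhd) (rule that)
    \<comment> \<open>The three bounds ensure that \<open>\<phi>\<close> is smaller at time
      \<open>-h\<close>, that the point stays in the ball, and that the possible loss
      \<open>h\<close> times \<open>\<eta> \<bullet> \<eta>\<close> is below the assumed gap
      \<open>u w - g w\<close>.\<close>
    define k where "k = min (min d d') ((u w - g w) / (\<eta> \<bullet> \<eta>))"
    have "0 < k" using d(1) d'(1) gu pos by (simp add: k_def)
    define h where "h = k / 2"
    have "0 < h" "h < k" using \<open>0 < k\<close> by (simp_all add: h_def)
    then have h: "0 < h" "h < d" "h < d'" "h < (u w - g w) / (\<eta> \<bullet> \<eta>)"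
      by (simp_all add: k_def)
    have in\<Omega>: "hline w \<eta> (- h) \<in> ball w \<rho> \<inter> \<Omega>" by (rule d'(2)) (use h in simp)
    have "\<phi> (hline w \<eta> (- h)) < \<phi> w" using d(2)[OF h(1,2)] by simp
    moreover have "u (hline w \<eta> (- h)) - \<phi> (hline w \<eta> (- h)) \<le> u w - \<phi> w"
      using in\<Omega> by (intro max) simp_all
    ultimately have "u (hline w \<eta> (- h)) < u w" by linarith
    then have "ereal (- h * (\<eta> \<bullet> \<eta>)) \<le> hamiltonian \<Omega> u w \<eta>"
      using in\<Omega> by (intro hamiltonian_ge False) simp_all
    then have "ereal (u w) + ereal (- h * (\<eta> \<bullet> \<eta>)) \<le> ereal (g w)"
      using add_left_mono le order_trans by blast
    then have "u w - g w \<le> h * (\<eta> \<bullet> \<eta>)" by simp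
    moreover have "h * (\<eta> \<bullet> \<eta>) < u w - g w" using h(4) pos by (simp add: pos_less_divide_eq)
    ultimately show False by linarith
  qed
qed

text \<open>There may be no test function touching \<open>u\<close> at \<open>p\<close> itself. A
  steep paraboloid centred at \<open>p\<close> moves the contact to a nearby \<open>w\<close> with
  \<open>u w \<ge> u p\<close>, where \<open>g\<close> is still below \<open>c\<close>.\<close>

lemma subsolution_le:
  assumes "open \<Omega>" and sub: "subsolution \<Omega> g u" and g: "usc_on \<Omega> g" and "p \<in> \<Omega>"
  shows "u p \<le> g p"
proof (rule ccontr)
  assume "\<not> u p \<le> g p"
  then obtain c where c: "g p < c" "c < u p" using dense[of "g p" "u p"] by auto
  have "open {x \<in> \<Omega>. g x < c}" using usc_on_iff_open_sublevel[OF assms(1)] g by blast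
  moreover have "p \<in> {x \<in> \<Omega>. g x < c}" using c \<open>p \<in> \<Omega>\<close> by simp
  ultimately obtain r where r: "0 < r" "cball p r \<subseteq> {x \<in> \<Omega>. g x < c}" using open_contains_cball by blast
  then have r\<Omega>: "cball p r \<subseteq> \<Omega>" by blast
  have usc: "usc_on \<Omega> u" using sub by (simp add: subsolution_def)
  obtain M where M: "\<forall>q\<in>cball p r. u q \<le> M"
    using usc_on_bdd_above_compact[OF assms(1) usc compact_cball r\<Omega>] unfolding bdd_above_def by blast
  \<comment> \<open>\<open>K\<close> is so large that on the sphere of radius r the penalty exceeds
    \<open>M - u p\<close>; the summand 1 makes this strict. So the maximum is interior.\<close>
  define K where "K = (M - u p) / r\<^sup>2 + 1"
  define \<phi> where "\<phi> q = K * ((q - p) \<bullet> (q - p))" for q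
  have "u p \<le> M" using M r(1) by simp
  then have K: "0 < K" "M - u p < K * r\<^sup>2" using r(1)
    by (simp_all add: K_def distrib_right add_nonneg_pos)
  have \<phi>: "C1_on \<Omega> \<phi>" unfolding \<phi>_def by (intro C1_on_mult C1_on_const C1_on_inner_diff)
  have "usc_on \<Omega> (\<lambda>q. u q - \<phi> q)"
    by (rule usc_on_diff_continuous[OF usc C1_on_imp_continuous_on[OF \<phi>]])
  moreover have "cball p r \<noteq> {}" using r(1) by simp
  ultimately obtain w where w: "w \<in> cball p r" "\<And>q. q \<in> cball p r \<Longrightarrow> u q - \<phi> q \<le> u w - \<phi> w"
    using usc_on_attains_max[OF assms(1) _ compact_cball r\<Omega>] by blast
  have wp: "u p + \<phi> w \<le> u w" using w(2)[of p] r(1) by (simp add: \<phi>_def)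
  have "norm (w - p) < r"
  proof (rule ccontr)
    assume "\<not> norm (w - p) < r"
    then have "r\<^sup>2 \<le> (w - p) \<bullet> (w - p)" using r(1) unfolding power2_norm_eq_inner[symmetric]
      by (intro power_mono) simp_all
    then have "K * r\<^sup>2 \<le> \<phi> w" unfolding \<phi>_def using K(1) by (intro mult_left_mono) simp_all
    moreover have "u w \<le> M" using M w(1) by blast
    ultimately show False using K(2) wp by linarith
  qed
  then have wball: "w \<in> ball p r" by (simp add: dist_norm norm_minus_commute)
  then obtain \<rho> where \<rho>: "0 < \<rho>" "ball w \<rho> \<subseteq> ball p r" using open_ball openE by blast
  have "u w \<le> g w"
  proof (rule subsolution_le_at_local_max[OF assms(1) sub _ \<rho>(1) \<phi>])
    show "w \<in> \<Omega>" using w(1) r\<Omega> by blast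
    show "u q - \<phi> q \<le> u w - \<phi> w" if "q \<in> ball w \<rho>" for q
      using w(2) \<rho>(2) that ball_subset_cball by blast
  qed
  moreover have "g w < c" using r(2) w(1) by blast
  moreover have "0 \<le> \<phi> w" using K(1) by (simp add: \<phi>_def)
  ultimately show False using c(2) wp by linarith
qed

text \<open>If a sublevel point lay in a direction of positive slope, a small step backwards would
  lower \<open>\<phi>\<close> and hence \<open>u\<close>. Then \<open>p\<close> would lie between
  two points with smaller values, against h-quasiconvexity.\<close>

lemma hamiltonian_nonpos:
  assumes "open \<Omega>" "h_quasiconvex_on \<Omega> u" "p \<in> \<Omega>" and \<phi>: "C1_on \<Omega> \<phi>"
    and max: "\<And>q. q \<in> \<Omega> \<Longrightarrow> u q - \<phi> q \<le> u p - \<phi> p"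
  shows "hamiltonian \<Omega> u p (hgrad \<phi> p) \<le> 0"
proof -
  have "hgrad \<phi> p \<bullet> hpart (hinv p \<cdot>\<^sub>H \<xi>) \<le> 0" if "\<xi> \<in> strict_sublevel \<Omega> u p" for \<xi>
  proof (rule ccontr)
    assume *: "\<not> hgrad \<phi> p \<bullet> hpart (hinv p \<cdot>\<^sub>H \<xi>) \<le> 0"
    have \<xi>: "\<xi> \<in> hplane p" "\<xi> \<in> \<Omega>" "u \<xi> < u p" using that by (simp_all add: strict_sublevel_def)
    then obtain v where v: "\<xi> = hline p v 1" using hplaneE by blast
    have pos: "0 < hgrad \<phi> p \<bullet> v" using * by (simp add: v hpart_hinv_hline)
    obtain d where d: "0 < d" "\<And>h. 0 < h \<Longrightarrow> h < d \<Longrightarrow> \<phi> (hline p v (0 - h)) < \<phi> (hline p v 0)"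
      using DERIV_pos_inc_left[OF C1_on_has_real_derivative_hline[OF \<phi> \<open>p \<in> \<Omega>\<close>] pos] by blast
    have "hline p v 0 \<in> \<Omega>" using assms(3) by simp
    with assms(1) obtain d' where d': "0 < d'" "\<And>t. \<bar>t - 0\<bar> < d' \<Longrightarrow> hline p v t \<in> \<Omega>"
      by (rule hline_in_open_nbhd) (rule that)
    define h where "h = min d d' / 2"
    have h: "0 < h" "h < d" "h < d'" using d(1) d'(1) unfolding h_def by linarith+
    have in\<Omega>: "hline p v (- h) \<in> \<Omega>" by (rule d'(2)) (use h in simp)
    have "\<phi> (hline p v (- h)) < \<phi> p" using d(2)[OF h(1,2)] by simp
    then have "u (hline p v (- h)) < u p" using max[OF in\<Omega>] by linarith
    moreover have "u (hline p v 0) \<le> max (u (hline p v (- h))) (u (hline p v 1))"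
      using h(1) \<xi>(2) by (intro h_quasiconvex_onD[OF assms(2) in\<Omega>]) (simp_all add: v)
    ultimately show False using \<xi>(3) by (simp add: v)
  qed
  then show ?thesis unfolding hamiltonian_def by (auto intro!: SUP_least)
qed

text \<open>Supplies a subsolution at every stage of the iteration, which makes all suprema
  finite.\<close>

lemma subsolution_h_quasiconvex:
  assumes "open \<Omega>" "usc_on \<Omega> u" "h_quasiconvex_on \<Omega> u" "locally_bounded_on \<Omega> u"
    and "\<And>p. p \<in> \<Omega> \<Longrightarrow> u p \<le> g p"
  shows "subsolution \<Omega> g u"
  unfolding subsolution_def
proof (intro conjI ballI allI impI assms)
  fix p \<phi> assume "p \<in> \<Omega>" and "C1_on \<Omega> \<phi> \<and> (\<forall>q\<in>\<Omega>. u q - \<phi> q \<le> u p - \<phi> p)"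
  then have "hamiltonian \<Omega> u p (hgrad \<phi> p) \<le> 0"
    using hamiltonian_nonpos[OF assms(1,3)] by blast
  then have "ereal (u p) + hamiltonian \<Omega> u p (hgrad \<phi> p) \<le> ereal (u p)"
    using add_left_mono[of _ 0 "ereal (u p)"] by simp
  also have "\<dots> \<le> ereal (g p)" using assms(5) \<open>p \<in> \<Omega>\<close> by simp
  finally show "ereal (u p) + hamiltonian \<Omega> u p (hgrad \<phi> p) \<le> ereal (g p)" .
qed

section \<open>Maximum of a subsolution and an h-quasiconvex function\<close>

lemma hamiltonian_mono:
  assumes "strict_sublevel \<Omega> u p \<subseteq> strict_sublevel \<Omega> w p"
  shows "hamiltonian \<Omega> u p \<eta> \<le> hamiltonian \<Omega> w p \<eta>"
  unfolding hamiltonian_def using assms by (simp add: SUP_subset_mono)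

lemma usc_on_max:
  fixes u w :: "'a::topological_space \<Rightarrow> 'b::linorder"
  assumes "usc_on \<Omega> u" "usc_on \<Omega> w"
  shows "usc_on \<Omega> (\<lambda>x. max (u x) (w x))"
  using assms unfolding usc_on_def by (simp add: eventually_conj)

text \<open>Local boundedness of \<open>w\<close> bounds the maximum from below; from above
  \<open>w\<close> and the semicontinuity of \<open>u\<close> do so together.\<close>

lemma locally_bounded_on_max:
  fixes u w :: "'a::metric_space \<Rightarrow> real"
  assumes "locally_bounded_on \<Omega> w" "usc_on \<Omega> u"
  shows "locally_bounded_on \<Omega> (\<lambda>x. max (w x) (u x))"
  unfolding locally_bounded_on_def
proof
  fix p assume p: "p \<in> \<Omega>"
  obtain r where r: "0 < r" "bounded (w ` (ball p r \<inter> \<Omega>))"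
    using assms(1) p unfolding locally_bounded_on_def by blast
  then obtain B where B: "\<And>x. x \<in> ball p r \<inter> \<Omega> \<Longrightarrow> \<bar>w x\<bar> \<le> B"
    unfolding bounded_iff by (metis imageI real_norm_def)
  have "\<forall>\<^sub>F q in at p within \<Omega>. u q < u p + 1"
    using assms(2) p unfolding usc_on_def by (meson less_add_one)
  then obtain d where d: "0 < d" "\<And>q. q \<in> \<Omega> \<Longrightarrow> q \<noteq> p \<Longrightarrow> dist q p < d \<Longrightarrow> u q < u p + 1"
    unfolding eventually_at by blast
  have "\<bar>max (w q) (u q)\<bar> \<le> B + \<bar>u p\<bar> + 1" if "q \<in> ball p (min r d) \<inter> \<Omega>" for q
  proof -
    have "u q < u p + 1" using d(2)[of q] that by (cases "q = p") (simp_all add: dist_commute)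
    moreover have "\<bar>w q\<bar> \<le> B" using B that by simp
    ultimately show ?thesis by linarith
  qed
  then have "bounded ((\<lambda>x. max (w x) (u x)) ` (ball p (min r d) \<inter> \<Omega>))"
    unfolding bounded_iff by (intro exI[of _ "B + \<bar>u p\<bar> + 1"]) auto
  then show "\<exists>r>0. bounded ((\<lambda>x. max (w x) (u x)) ` (ball p r \<inter> \<Omega>))"
    using r(1) d(1) by (intro exI[of _ "min r d"]) simp
qed

text \<open>At a test point the maximum equals one of the two functions, which the same
  \<open>\<phi>\<close> then tests. Its strict sublevel set contains that of the maximum, so passing
  to the maximum only lowers the Hamiltonian.\<close>

lemma subsolution_max:
  assumes "open \<Omega>" "usc_on \<Omega> u" "h_quasiconvex_on \<Omega> u"
    and ug: "\<And>p. p \<in> \<Omega> \<Longrightarrow> u p \<le> g p" and w: "subsolution \<Omega> g w"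
  shows "subsolution \<Omega> g (\<lambda>x. max (w x) (u x))" (is "subsolution \<Omega> g ?m")
  unfolding subsolution_def
proof (intro conjI ballI allI impI)
  show "usc_on \<Omega> ?m" using w assms(2) unfolding subsolution_def by (intro usc_on_max) blast+
  show "locally_bounded_on \<Omega> ?m"
    using w assms(2) unfolding subsolution_def by (intro locally_bounded_on_max) blast+
next
  fix p \<phi> assume p: "p \<in> \<Omega>" and "C1_on \<Omega> \<phi> \<and> (\<forall>q\<in>\<Omega>. ?m q - \<phi> q \<le> ?m p - \<phi> p)"
  then have \<phi>: "C1_on \<Omega> \<phi>" and max: "\<And>q. q \<in> \<Omega> \<Longrightarrow> ?m q - \<phi> q \<le> ?m p - \<phi> p" by blast+
  show "ereal (?m p) + hamiltonian \<Omega> ?m p (hgrad \<phi> p) \<le> ereal (g p)"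
  proof (cases "u p \<le> w p")
    case True
    have "w q - \<phi> q \<le> w p - \<phi> p" if "q \<in> \<Omega>" for q using max[OF that] True by linarith
    then have "ereal (w p) + hamiltonian \<Omega> w p (hgrad \<phi> p) \<le> ereal (g p)"
      using w p \<phi> unfolding subsolution_def by blast
    moreover have "hamiltonian \<Omega> ?m p (hgrad \<phi> p) \<le> hamiltonian \<Omega> w p (hgrad \<phi> p)"
      using True by (intro hamiltonian_mono) (auto simp: strict_sublevel_def)
    then have "ereal (w p) + hamiltonian \<Omega> ?m p (hgrad \<phi> p) \<le> ereal (w p) + hamiltonian \<Omega> w p (hgrad \<phi> p)"
      by (rule add_left_mono)
    ultimately show ?thesis using True by (simp add: max_absorb1)
  next
    case False
    have "u q - \<phi> q \<le> u p - \<phi> p" if "q \<in> \<Omega>" for q using max[OF that] False by linarith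
    then have "hamiltonian \<Omega> u p (hgrad \<phi> p) \<le> 0"
      by (intro hamiltonian_nonpos[OF assms(1,3) p \<phi>])
    moreover have "hamiltonian \<Omega> ?m p (hgrad \<phi> p) \<le> hamiltonian \<Omega> u p (hgrad \<phi> p)"
      using False by (intro hamiltonian_mono) (auto simp: strict_sublevel_def)
    ultimately have "hamiltonian \<Omega> ?m p (hgrad \<phi> p) \<le> 0" by (rule order_trans[rotated])
    then have "ereal (u p) + hamiltonian \<Omega> ?m p (hgrad \<phi> p) \<le> ereal (u p)"
      using add_left_mono[of _ 0 "ereal (u p)"] by simp
    also have "\<dots> \<le> ereal (g p)" using ug[OF p] by simp
    finally show ?thesis using False by (simp add: max_absorb2)
  qed
qed

section \<open>Semicontinuous envelopes\<close>

lemma usc_on_ereal_iff: "usc_on \<Omega> (\<lambda>p. ereal (u p)) \<longleftrightarrow> usc_on \<Omega> u"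
proof
  assume u: "usc_on \<Omega> (\<lambda>p. ereal (u p))"
  show "usc_on \<Omega> u" unfolding usc_on_def
  proof (intro ballI allI impI)
    fix p c assume "p \<in> \<Omega>" "u p < c"
    then have "ereal (u p) < ereal c" by simp
    with u \<open>p \<in> \<Omega>\<close> have "\<forall>\<^sub>F q in at p within \<Omega>. ereal (u q) < ereal c" unfolding usc_on_def by blast
    then show "\<forall>\<^sub>F q in at p within \<Omega>. u q < c" by simp
  qed
next
  assume u: "usc_on \<Omega> u"
  show "usc_on \<Omega> (\<lambda>p. ereal (u p))" unfolding usc_on_def
  proof (intro ballI allI impI)
    fix p c assume "p \<in> \<Omega>" "ereal (u p) < c"
    then show "\<forall>\<^sub>F q in at p within \<Omega>. ereal (u q) < c"
      using u unfolding usc_on_def by (cases c) simp_all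
  qed
qed

lemma usc_on_cong: "(\<And>p. p \<in> \<Omega> \<Longrightarrow> u p = w p) \<Longrightarrow> usc_on \<Omega> u \<longleftrightarrow> usc_on \<Omega> w"
  unfolding usc_on_def by (simp add: eventually_at_filter cong: ball_cong conj_cong imp_cong)

lemma usc_env_less_iff:
  "usc_env \<Omega> v p < c \<longleftrightarrow> (\<exists>r>0. (SUP q \<in> ball p r \<inter> \<Omega>. v q) < c)"
  unfolding usc_env_def INF_less_iff by auto

lemma usc_env_ge: "p \<in> \<Omega> \<Longrightarrow> v p \<le> usc_env \<Omega> v p"
  unfolding usc_env_def by (auto intro!: INF_greatest SUP_upper)

lemma usc_on_usc_env: "usc_on \<Omega> (usc_env \<Omega> v)"
  unfolding usc_on_def
proof (intro ballI allI impI)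
  fix p c assume "p \<in> \<Omega>" "usc_env \<Omega> v p < c"
  then obtain r where r: "0 < r" "(SUP q \<in> ball p r \<inter> \<Omega>. v q) < c"
    unfolding usc_env_less_iff by blast
  have "usc_env \<Omega> v q < c" if "dist q p < r" for q
  proof -
    have "ball q (r - dist q p) \<subseteq> ball p r"
    proof
      fix x assume "x \<in> ball q (r - dist q p)"
      then show "x \<in> ball p r" using dist_triangle[of p x q] by (simp add: dist_commute)
    qed
    then have "(SUP q \<in> ball q (r - dist q p) \<inter> \<Omega>. v q) \<le> (SUP q \<in> ball p r \<inter> \<Omega>. v q)"
      by (intro SUP_subset_mono) auto
    then show ?thesis unfolding usc_env_less_iff using r(2) that
      by (intro exI[of _ "r - dist q p"]) simp
  qed
  then show "\<forall>\<^sub>F q in at p within \<Omega>. usc_env \<Omega> v q < c"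
    unfolding eventually_at using r(1) by blast
qed

text \<open>The envelope at \<open>p\<close> depends only on values near \<open>p\<close>, so a
  bound on an open neighbourhood \<open>S\<close> suffices; this is used with thin tubes.\<close>

lemma usc_env_le:
  fixes h :: "'a::metric_space \<Rightarrow> real"
  assumes "open S" "usc_on S h" "p \<in> S" and le: "\<And>q. q \<in> S \<Longrightarrow> v q \<le> ereal (h q)"
  shows "usc_env \<Omega> v p \<le> ereal (h p)"
proof (rule ereal_le_epsilon2)
  fix e :: real assume "0 < e"
  have "open {x \<in> S. h x < h p + e}" using usc_on_iff_open_sublevel assms(1,2) by blast
  moreover have "p \<in> {x \<in> S. h x < h p + e}" using \<open>0 < e\<close> assms(3) by simp
  ultimately obtain r where r: "0 < r" "ball p r \<subseteq> {x \<in> S. h x < h p + e}" using openE by blast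
  have "usc_env \<Omega> v p \<le> (SUP q \<in> ball p r \<inter> \<Omega>. v q)"
    unfolding usc_env_def using r(1) by (intro INF_lower) simp
  also have "\<dots> \<le> ereal (h p + e)"
  proof (rule SUP_least)
    fix q assume "q \<in> ball p r \<inter> \<Omega>"
    then have "q \<in> S" "h q < h p + e" using r(2) by blast+
    then show "v q \<le> ereal (h p + e)" using le[of q] order_trans by fastforce
  qed
  finally show "usc_env \<Omega> v p \<le> ereal (h p) + ereal e" by simp
qed

text \<open>Real bounds on both sides make the envelope finite, so it can be passed on as a
  real-valued function.\<close>

lemma usc_env_real:
  fixes g h :: "'a::metric_space \<Rightarrow> real"
  assumes "open \<Omega>" "usc_on \<Omega> h"
    and "\<And>q. q \<in> \<Omega> \<Longrightarrow> ereal (g q) \<le> v q" "\<And>q. q \<in> \<Omega> \<Longrightarrow> v q \<le> ereal (h q)"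
  obtains V where "\<And>p. p \<in> \<Omega> \<Longrightarrow> ereal (V p) = usc_env \<Omega> v p" "usc_on \<Omega> V"
    "\<And>p. p \<in> \<Omega> \<Longrightarrow> g p \<le> V p" "\<And>p. p \<in> \<Omega> \<Longrightarrow> V p \<le> h p"
proof -
  define V where "V p = real_of_ereal (usc_env \<Omega> v p)" for p
  have lower: "ereal (g p) \<le> usc_env \<Omega> v p" if "p \<in> \<Omega>" for p
    using assms(3)[OF that] usc_env_ge[OF that] by (rule order_trans)
  have upper: "usc_env \<Omega> v p \<le> ereal (h p)" if "p \<in> \<Omega>" for p
    using assms(1,2) that assms(4) by (rule usc_env_le)
  have V: "ereal (V p) = usc_env \<Omega> v p" if "p \<in> \<Omega>" for p
    using lower[OF that] upper[OF that] unfolding V_def by (cases "usc_env \<Omega> v p") simp_all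
  show ?thesis
  proof
    show "ereal (V p) = usc_env \<Omega> v p" if "p \<in> \<Omega>" for p by (rule V[OF that])
    have "usc_on \<Omega> (\<lambda>p. ereal (V p)) \<longleftrightarrow> usc_on \<Omega> (usc_env \<Omega> v)"
      by (rule usc_on_cong) (rule V)
    then have "usc_on \<Omega> (\<lambda>p. ereal (V p))" using usc_on_usc_env by blast
    then show "usc_on \<Omega> V" by (simp only: usc_on_ereal_iff)
    show "g p \<le> V p" if "p \<in> \<Omega>" for p using lower[OF that] unfolding V[OF that, symmetric] by simp
    show "V p \<le> h p" if "p \<in> \<Omega>" for p using upper[OF that] unfolding V[OF that, symmetric] by simp
  qed
qed

text \<open>With direction and times fixed, the two end points depend continuously on the
  intermediate point. If the envelope is below \<open>c\<close> at both ends, then \<open>u\<close>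
  is below \<open>c\<close> near both ends, hence at most \<open>c\<close> near the intermediate
  point.\<close>

lemma h_quasiconvex_usc_env:
  assumes "open \<Omega>" "h_convex \<Omega>" "h_quasiconvex_on \<Omega> u"
    and U: "\<And>p. p \<in> \<Omega> \<Longrightarrow> ereal (U p) = usc_env \<Omega> (\<lambda>p. ereal (u p)) p"
  shows "h_quasiconvex_on \<Omega> U"
  unfolding h_quasiconvex_on_iff_hline
proof (intro allI impI, rule ccontr)
  fix p v and s :: real
  assume p: "p \<in> \<Omega>" and q: "hline p v 1 \<in> \<Omega>" and s: "0 \<le> s" "s \<le> 1"
  define w where "w = hline p v s"
  assume "\<not> U (hline p v s) \<le> max (U p) (U (hline p v 1))"
  then have "max (U p) (U (hline p v 1)) < U w" by (simp only: w_def not_le)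
  then obtain c where c: "max (U p) (U (hline p v 1)) < c" "c < U w" using dense by blast
  have nbhd: "\<exists>T. open T \<and> x \<in> T \<and> T \<subseteq> \<Omega> \<and> (\<forall>y\<in>T. u y < c)" if x: "x \<in> \<Omega>" "U x < c" for x
  proof -
    have "usc_env \<Omega> (\<lambda>p. ereal (u p)) x < ereal c" using x(2) unfolding U[OF x(1), symmetric] by simp
    then obtain r where r: "0 < r" "(SUP q \<in> ball x r \<inter> \<Omega>. ereal (u q)) < ereal c"
      unfolding usc_env_less_iff by blast
    have "u y < c" if "y \<in> ball x r \<inter> \<Omega>" for y
      using le_less_trans[OF SUP_upper[OF that] r(2)] by simp
    then show ?thesis using r(1) x(1) assms(1) by (intro exI[of _ "ball x r \<inter> \<Omega>"]) (simp add: open_Int)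
  qed
  have p0: "hline w v (0 - s) = p" and q0: "hline w v (1 - s) = hline p v 1"
    by (simp_all add: w_def hline_hline)
  obtain T0 where T0: "open T0" "p \<in> T0" "T0 \<subseteq> \<Omega>" "\<forall>y\<in>T0. u y < c"
    using nbhd[OF p] c by auto
  obtain T1 where T1: "open T1" "hline p v 1 \<in> T1" "T1 \<subseteq> \<Omega>" "\<forall>y\<in>T1. u y < c"
    using nbhd[OF q] c by auto
  define S where "S = \<Omega> \<inter> (\<lambda>y. hline y v (0 - s)) -` T0 \<inter> (\<lambda>y. hline y v (1 - s)) -` T1"
  have "open S" unfolding S_def
    by (intro open_Int assms(1) open_vimage T0 T1 continuous_intros)
  moreover have "w \<in> \<Omega>"
    unfolding w_def using h_convexD[OF assms(2), of p v 0 1 s] p q s by simp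
  then have "w \<in> S" unfolding S_def using T0 T1 p0 q0 by simp
  moreover have "ereal (u y) \<le> ereal c" if "y \<in> S" for y
  proof -
    have "hline y v (0 - s) \<in> T0" "hline y v (1 - s) \<in> T1" using that unfolding S_def by blast+
    then have "u (hline y v (0 - s)) < c" "u (hline y v (1 - s)) < c"
      "hline y v (0 - s) \<in> \<Omega>" "hline y v (1 - s) \<in> \<Omega>" using T0 T1 by blast+
    moreover from this have "u (hline y v 0) \<le> max (u (hline y v (0 - s))) (u (hline y v (1 - s)))"
      using s by (intro h_quasiconvex_onD[OF assms(3)]) simp_all
    ultimately show ?thesis by simp
  qed
  moreover have "usc_on S (\<lambda>_. c)" by (simp add: usc_on_def)
  ultimately have "usc_env \<Omega> (\<lambda>p. ereal (u p)) w \<le> ereal c"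
    by (intro usc_env_le[of S "\<lambda>_. c" w])
  then have "U w \<le> c" unfolding U[OF \<open>w \<in> \<Omega>\<close>, symmetric] by simp
  then show False using c(2) by linarith
qed

text \<open>Pointwise suprema preserve h-quasiconvexity. The semicontinuous envelope
  \<open>V\<close> of the supremum is again h-quasiconvex and stays below the upper semicontinuous
  \<open>f\<close>, so it is a competitor itself and equals \<open>E\<close>.\<close>

lemma hq_envelope_attained:
  assumes "open \<Omega>" "h_convex \<Omega>" "usc_on \<Omega> f" "h_quasiconvex_on \<Omega> g"
    and "\<And>p. p \<in> \<Omega> \<Longrightarrow> g p \<le> f p"
  obtains E where "\<And>p. p \<in> \<Omega> \<Longrightarrow> hq_envelope \<Omega> f p = ereal (E p)" "usc_on \<Omega> E"
    "h_quasiconvex_on \<Omega> E" "\<And>p. p \<in> \<Omega> \<Longrightarrow> E p \<le> f p"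
    "\<And>u p. h_quasiconvex_on \<Omega> u \<Longrightarrow> (\<And>q. q \<in> \<Omega> \<Longrightarrow> u q \<le> f q) \<Longrightarrow> p \<in> \<Omega> \<Longrightarrow> u p \<le> E p"
proof -
  let ?A = "{u. h_quasiconvex_on \<Omega> u \<and> (\<forall>q\<in>\<Omega>. u q \<le> f q)}"
  have upper: "ereal (u p) \<le> hq_envelope \<Omega> f p" if "u \<in> ?A" for u p
    unfolding hq_envelope_def using that by (rule SUP_upper)
  have "g \<in> ?A" using assms by blast
  have le: "hq_envelope \<Omega> f p \<le> ereal (f p)" if "p \<in> \<Omega>" for p
    unfolding hq_envelope_def using that by (intro SUP_least) simp
  define E where "E p = real_of_ereal (hq_envelope \<Omega> f p)" for p
  have E: "hq_envelope \<Omega> f p = ereal (E p)" if "p \<in> \<Omega>" for p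
    using le[OF that] upper[OF \<open>g \<in> ?A\<close>, of p] unfolding E_def
    by (cases "hq_envelope \<Omega> f p") simp_all
  have E_ge: "u p \<le> E p" if "u \<in> ?A" "p \<in> \<Omega>" for u p
    using upper[OF that(1), of p] unfolding E[OF that(2)] by simp
  have E_le: "E p \<le> f p" if "p \<in> \<Omega>" for p using le[OF that] E[OF that] by simp
  have E_hq: "h_quasiconvex_on \<Omega> E" unfolding h_quasiconvex_on_iff_hline
  proof (intro allI impI)
    fix p v and s :: real
    assume p: "p \<in> \<Omega>" and q: "hline p v 1 \<in> \<Omega>" and s: "0 \<le> s" "s \<le> 1"
    have w: "hline p v s \<in> \<Omega>" using h_convexD[OF assms(2), of p v 0 1 s] p q s by simp
    have "hq_envelope \<Omega> f (hline p v s) \<le> ereal (max (E p) (E (hline p v 1)))"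
      unfolding hq_envelope_def
    proof (rule SUP_least)
      fix u assume u: "u \<in> ?A"
      then have "u (hline p v s) \<le> max (u p) (u (hline p v 1))"
        using p q s unfolding h_quasiconvex_on_iff_hline by blast
      also have "\<dots> \<le> max (E p) (E (hline p v 1))"
        using E_ge[OF u] p q by (intro max.mono)
      finally show "ereal (u (hline p v s)) \<le> ereal (max (E p) (E (hline p v 1)))" by (simp only: ereal_less_eq(3))
    qed
    then show "E (hline p v s) \<le> max (E p) (E (hline p v 1))" unfolding E[OF w] by (simp only: ereal_less_eq(3))
  qed
  obtain V where V: "\<And>p. p \<in> \<Omega> \<Longrightarrow> ereal (V p) = usc_env \<Omega> (\<lambda>p. ereal (E p)) p" "usc_on \<Omega> V"
    "\<And>p. p \<in> \<Omega> \<Longrightarrow> E p \<le> V p" "\<And>p. p \<in> \<Omega> \<Longrightarrow> V p \<le> f p"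
    by (rule usc_env_real[OF assms(1,3), of E "\<lambda>p. ereal (E p)"]) (simp, simp add: E_le, rule that)
  have "V \<in> ?A" using h_quasiconvex_usc_env[OF assms(1,2) E_hq V(1)] V(4) by blast
  then have "E p = V p" if "p \<in> \<Omega>" for p using E_ge[OF \<open>V \<in> ?A\<close> that] V(3)[OF that] by simp
  then have "usc_on \<Omega> E \<longleftrightarrow> usc_on \<Omega> V" by (rule usc_on_cong)
  with V(2) have "usc_on \<Omega> E" by blast
  show ?thesis
  proof (rule that[OF E \<open>usc_on \<Omega> E\<close> E_hq E_le])
    show "u p \<le> E p" if "h_quasiconvex_on \<Omega> u" "\<And>q. q \<in> \<Omega> \<Longrightarrow> u q \<le> f q" "p \<in> \<Omega>" for u p
      using that by (intro E_ge) blast+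
  qed
qed

section \<open>Existence of the iteration\<close>

lemma sup_subsolutions_le:
  assumes "open \<Omega>" "usc_on \<Omega> g" "p \<in> \<Omega>"
  shows "sup_subsolutions \<Omega> g p \<le> ereal (g p)"
  unfolding sup_subsolutions_def using subsolution_le assms by (intro SUP_least) simp

lemma sup_subsolutions_ge: "subsolution \<Omega> g u \<Longrightarrow> ereal (u p) \<le> sup_subsolutions \<Omega> g p"
  unfolding sup_subsolutions_def by (intro SUP_upper) simp

text \<open>The invariant is that each iterate is upper semicontinuous and lies above
  \<open>g\<close>. Then \<open>g\<close> is a subsolution for the next step, and the next envelope
  is squeezed between \<open>g\<close> and the current iterate.\<close>

lemma hq_iteration_exists:
  assumes "open \<Omega>" "usc_on \<Omega> f" "usc_on \<Omega> g" "h_quasiconvex_on \<Omega> g" "locally_bounded_on \<Omega> g"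
    and gf: "\<And>p. p \<in> \<Omega> \<Longrightarrow> g p \<le> f p"
  obtains u where "hq_iteration \<Omega> f u"
proof -
  let ?P = "\<lambda>w. usc_on \<Omega> w \<and> (\<forall>p\<in>\<Omega>. g p \<le> w p)"
  let ?R = "\<lambda>w w'. \<forall>p\<in>\<Omega>. ereal (w' p) = usc_env \<Omega> (sup_subsolutions \<Omega> w) p"
  have "\<exists>w'. ?P w' \<and> ?R w w'" if w: "?P w" for w
  proof -
    have "subsolution \<Omega> w g" using w assms by (intro subsolution_h_quasiconvex) blast+
    then have ge: "ereal (g p) \<le> sup_subsolutions \<Omega> w p" for p by (rule sup_subsolutions_ge)
    have le: "sup_subsolutions \<Omega> w p \<le> ereal (w p)" if "p \<in> \<Omega>" for p
      using sup_subsolutions_le[OF assms(1) _ that] w by blast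
    obtain w' where "\<And>p. p \<in> \<Omega> \<Longrightarrow> ereal (w' p) = usc_env \<Omega> (sup_subsolutions \<Omega> w) p" "usc_on \<Omega> w'"
      "\<And>p. p \<in> \<Omega> \<Longrightarrow> g p \<le> w' p"
      by (rule usc_env_real[OF assms(1) conjunct1[OF w] ge le]) (assumption+, rule that)
    then show ?thesis by blast
  qed
  note ex = this
  define F where "F w = (SOME w'. ?P w' \<and> ?R w w')" for w
  have F: "?P (F w) \<and> ?R w (F w)" if "?P w" for w
    unfolding F_def using someI_ex[OF ex[OF that]] .
  define u where "u n = (F ^^ n) f" for n
  have u: "u 0 = f" "u (Suc n) = F (u n)" for n by (simp_all add: u_def)
  have P: "?P (u n)" for n
  proof (induction n)
    case 0 then show ?case using assms u(1) by simp
  next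
    case (Suc n) then show ?case using F u(2) by simp
  qed
  have "hq_iteration \<Omega> f u" unfolding hq_iteration_def
    using P F[OF P] by (simp add: u)
  then show ?thesis by (rule that)
qed

section \<open>The limit of the iteration\<close>

text \<open>\<open>S\<close> is the time along the horizontal flow in direction \<open>v\<close>; \<open>I\<close> and \<open>J\<close> are polynomials invariant
  under this flow.\<close>

lemma exists_flow_box_chart:
  assumes "v \<noteq> 0"
  obtains G :: "real \<times> real \<times> real \<Rightarrow> heis" and S I J :: "heis \<Rightarrow> real"
  where "continuous_on UNIV G" "C1_on UNIV S" "C1_on UNIV I" "C1_on UNIV J"
    "\<And>x. G (S x, I x, J x) = x"
    "\<And>s i j. S (G (s, i, j)) = s" "\<And>s i j. I (G (s, i, j)) = i" "\<And>s i j. J (G (s, i, j)) = j"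
    "\<And>s i j t. hline (G (s, i, j)) v t = G (s + t, i, j)" "G (0, 0, 0) = p"
proof -
  obtain a b where v: "v = (a, b)" by (cases v) auto
  obtain x0 y0 z0 where p: "p = (x0, y0, z0)" by (cases p) auto
  define L where "L = a\<^sup>2 + b\<^sup>2"
  have L: "L \<noteq> 0" using assms by (simp add: v L_def zero_prod_def sum_power2_eq_zero_iff)
  \<comment> \<open>Starting at \<open>p\<close>, move by \<open>i\<close> across \<open>v\<close>
    and by \<open>j\<close> vertically, then flow for time \<open>s\<close>. Left translation by the
    inverse of \<open>p\<close> and the vertical drift \<open>s * i / 2\<close> of the flow account
    for the correction terms in \<open>J\<close>.\<close>
  define G where "G w = hline (p \<cdot>\<^sub>H (b * fst (snd w) / L, - a * fst (snd w) / L, snd (snd w))) v (fst w)"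
    for w :: "real \<times> real \<times> real"
  define S where "S x = (1 / L) * (a * (fst x - x0) + b * (fst (snd x) - y0))" for x :: heis
  define I where "I x = b * (fst x - x0) - a * (fst (snd x) - y0)" for x :: heis
  define J where "J x = snd (snd x) - z0 - (1/2) * (x0 * fst (snd x) - y0 * fst x) - (1/2) * (S x * I x)"
    for x :: heis
  show ?thesis
  proof
    show "continuous_on UNIV G" unfolding G_def p hmult.simps by (intro continuous_intros ballI L)
    show S: "C1_on UNIV S" unfolding S_def
      by (intro C1_on_mult C1_on_add C1_on_diff C1_on_const C1_on_fst C1_on_fst_snd)
    show I: "C1_on UNIV I" unfolding I_def
      by (intro C1_on_mult C1_on_add C1_on_diff C1_on_const C1_on_fst C1_on_fst_snd)
    show "C1_on UNIV J" unfolding J_def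
      by (intro C1_on_mult C1_on_add C1_on_diff C1_on_const C1_on_fst C1_on_fst_snd C1_on_snd_snd S I)
    show "hline (G (s, i, j)) v t = G (s + t, i, j)" for s i j t
      by (simp add: G_def hline_hline)
    show "G (0, 0, 0) = p" by (simp add: G_def p)
    have Gs: "G (s, i, j) = (x0 + b * i / L + s * a, y0 - a * i / L + s * b,
        z0 + j - (1/2) * (x0 * (a * i / L) + y0 * (b * i / L)) +
        (1/2) * ((x0 + b * i / L) * (s * b) - s * a * (y0 - a * i / L)))" for s i j
      by (simp add: G_def hline_def p v algebra_simps)
    show SG: "S (G (s, i, j)) = s" for s i j
    proof -
      have "a * (b * i / L + s * a) + b * (s * b - a * i / L) = s * L"
        by (simp add: L_def power2_eq_square algebra_simps)
      then show ?thesis using L by (simp add: S_def Gs algebra_simps)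
    qed
    show IG: "I (G (s, i, j)) = i" for s i j
    proof -
      have "b * (b * i / L + s * a) - a * (s * b - a * i / L) = (a\<^sup>2 + b\<^sup>2) * i / L"
        by (simp add: power2_eq_square algebra_simps add_divide_distrib)
      then show ?thesis using L by (simp add: I_def Gs L_def[symmetric] algebra_simps)
    qed
    show "J (G (s, i, j)) = j" for s i j
    proof -
      have "(b * i / L) * (s * b) + s * a * (a * i / L) = s * ((a\<^sup>2 + b\<^sup>2) * i / L)"
        by (simp add: power2_eq_square algebra_simps add_divide_distrib)
      then have *: "(b * i / L) * (s * b) + s * a * (a * i / L) = s * i" using L by (simp add: L_def[symmetric])
      show ?thesis unfolding J_def SG IG using * by (simp add: Gs algebra_simps)
    qed
    show "G (S x, I x, J x) = x" for x
    proof -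
      obtain x1 x2 x3 where x: "x = (x1, x2, x3)" by (cases x) auto
      define n where "n = a * (x1 - x0) + b * (x2 - y0)"
      have Sx: "S x = n / L" by (simp add: S_def x n_def)
      have 1: "b * I x / L + S x * a = x1 - x0"
      proof -
        have "b * I x + a * n = (x1 - x0) * L"
          by (simp add: I_def n_def x L_def power2_eq_square algebra_simps)
        moreover have "b * I x / L + S x * a = (b * I x + a * n) / L"
          by (simp add: Sx add_divide_distrib mult.commute)
        ultimately show ?thesis using L by simp
      qed
      have 2: "S x * b - a * I x / L = x2 - y0"
      proof -
        have "b * n - a * I x = (x2 - y0) * L"
          by (simp add: I_def n_def x L_def power2_eq_square algebra_simps)
        moreover have "S x * b - a * I x / L = (b * n - a * I x) / L"
          by (simp add: Sx diff_divide_distrib mult.commute)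
        ultimately show ?thesis using L by simp
      qed
      have 3: "(b * I x / L) * (S x * b) + S x * a * (a * I x / L) = S x * I x"
      proof -
        have "(b * I x / L) * (S x * b) + S x * a * (a * I x / L) = S x * ((a\<^sup>2 + b\<^sup>2) * I x / L)"
          by (simp add: power2_eq_square algebra_simps add_divide_distrib)
        then show ?thesis using L by (simp add: L_def[symmetric])
      qed
      have "z0 + J x - (1/2) * (x0 * (a * I x / L) + y0 * (b * I x / L)) +
        (1/2) * ((x0 + b * I x / L) * (S x * b) - S x * a * (y0 - a * I x / L)) =
        z0 + J x + (1/2) * (x0 * (S x * b - a * I x / L) - y0 * (b * I x / L + S x * a)) +
        (1/2) * ((b * I x / L) * (S x * b) + S x * a * (a * I x / L))"
        by (simp add: algebra_simps)
      also have "\<dots> = x3" unfolding 1 2 3 by (simp add: J_def x algebra_simps)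
      finally show ?thesis unfolding Gs using 1 2 by (simp add: x algebra_simps)
    qed
  qed
qed

lemma open_contains_box:
  assumes "open V" "(s, 0, 0) \<in> V"
  obtains \<kappa> where "0 < \<kappa>"
    "\<And>t i j. \<bar>t - s\<bar> \<le> \<kappa> \<Longrightarrow> \<bar>i\<bar> \<le> \<kappa> \<Longrightarrow> \<bar>j\<bar> \<le> \<kappa> \<Longrightarrow> (t, i, j) \<in> (V :: (real \<times> real \<times> real) set)"
proof -
  obtain r where r: "0 < r" "ball (s, 0, 0) r \<subseteq> V" using assms openE by blast
  \<comment> \<open>Three coordinate differences of at most \<open>r / 4\<close> add up to less than
    r.\<close>
  have "(t, i, j) \<in> V" if "\<bar>t - s\<bar> \<le> r / 4" "\<bar>i\<bar> \<le> r / 4" "\<bar>j\<bar> \<le> r / 4" for t i j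
  proof -
    have "norm (t - s, i, j) \<le> norm (t - s) + norm (i, j)" by (rule norm_Pair_le)
    also have "\<dots> \<le> norm (t - s) + (norm i + norm j)" by (intro add_left_mono norm_Pair_le)
    also have "\<dots> < r" using that r(1) by simp
    finally have "dist (t, i, j) (s, 0, 0) < r" by (simp add: dist_norm)
    then have "(t, i, j) \<in> ball (s, 0, 0) r" by (simp add: dist_commute)
    then show ?thesis using r(2) by blast
  qed
  then show ?thesis using r(1) by (intro that[of "r / 4"]) simp_all
qed

text \<open>The gain per step is \<open>\<epsilon> * \<kappa>\<close>: the slope of the test
  function along the flow times the least time left, at a relevant maximum point, until the end of
  the tube.\<close>

lemma h_quasiconvex_iteration_limit:
  assumes \<Omega>: "open \<Omega>" "h_convex \<Omega>" and usc: "\<And>n. usc_on \<Omega> (u n)"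
    and step: "\<And>n p. p \<in> \<Omega> \<Longrightarrow> ereal (u (Suc n) p) = usc_env \<Omega> (sup_subsolutions \<Omega> (u n)) p"
    and dec: "\<And>n p. p \<in> \<Omega> \<Longrightarrow> u (Suc n) p \<le> u n p"
    and lim: "\<And>p. p \<in> \<Omega> \<Longrightarrow> (\<lambda>n. u n p) \<longlonglongrightarrow> U p"
  shows "h_quasiconvex_on \<Omega> U"
  unfolding h_quasiconvex_on_iff_hline
proof (intro allI impI, rule ccontr)
  fix p v and s0 :: real
  assume p: "p \<in> \<Omega>" and q: "hline p v 1 \<in> \<Omega>" and s0: "0 \<le> s0" "s0 \<le> 1"
    and "\<not> U (hline p v s0) \<le> max (U p) (U (hline p v 1))"
  then have less: "max (U p) (U (hline p v 1)) < U (hline p v s0)" by (simp only: not_le)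
  have "v \<noteq> 0"
  proof
    assume "v = 0"
    then have "hline p v s0 = p" by (cases p) (simp add: hline_def)
    then show False using less by simp
  qed
  have s0': "0 < s0" "s0 < 1"
  proof -
    have "s0 \<noteq> 0" "s0 \<noteq> 1" using less by auto
    then show "0 < s0" "s0 < 1" using s0 by linarith+
  qed
  obtain c where c: "max (U p) (U (hline p v 1)) < c" "c < U (hline p v s0)" using dense[OF less] by blast
  obtain G :: "real \<times> real \<times> real \<Rightarrow> heis" and S I J :: "heis \<Rightarrow> real"
    where G: "continuous_on UNIV G" "C1_on UNIV S" "C1_on UNIV I" "C1_on UNIV J"
    and GSIJ: "\<And>x. G (S x, I x, J x) = x"
    and SG: "\<And>s i j. S (G (s, i, j)) = s" and IG: "\<And>s i j. I (G (s, i, j)) = i"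
    and JG: "\<And>s i j. J (G (s, i, j)) = j"
    and hG: "\<And>s i j t. hline (G (s, i, j)) v t = G (s + t, i, j)" and G0: "G (0, 0, 0) = p"
    by (rule exists_flow_box_chart[OF \<open>v \<noteq> 0\<close>, of p]) (rule that)
  have Gp: "G (s, 0, 0) = hline p v s" for s using hG[of 0 0 0 s] by (simp add: G0)
  \<comment> \<open>One index \<open>N\<close> at which both ends are below \<open>c\<close> serves
    for all later ones, since the iterates decrease.\<close>
  have "\<forall>\<^sub>F n in sequentially. u n p < c \<and> u n (hline p v 1) < c"
    using order_tendstoD(2)[OF lim[OF p]] order_tendstoD(2)[OF lim[OF q]] c(1)
    by (intro eventually_conj) simp_all
  then obtain N where N: "u N p < c" "u N (hline p v 1) < c" unfolding eventually_sequentially by blast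
  define T where "T = {x \<in> \<Omega>. u N x < c}"
  have "open T" unfolding T_def using usc_on_iff_open_sublevel[OF \<Omega>(1)] usc by blast
  then have GT: "open (G -` T)" using G(1) by (intro open_vimage)
  have "(0, 0, 0) \<in> G -` T" using N(1) p by (simp add: T_def G0)
  then obtain \<kappa>0 where \<kappa>0: "0 < \<kappa>0"
    "\<And>t i j. \<bar>t - 0\<bar> \<le> \<kappa>0 \<Longrightarrow> \<bar>i\<bar> \<le> \<kappa>0 \<Longrightarrow> \<bar>j\<bar> \<le> \<kappa>0 \<Longrightarrow> (t, i, j) \<in> G -` T"
    by (rule open_contains_box[OF GT]) (rule that)
  have "(1, 0, 0) \<in> G -` T" using N(2) q by (simp add: T_def Gp)
  then obtain \<kappa>1 where \<kappa>1: "0 < \<kappa>1"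
    "\<And>t i j. \<bar>t - 1\<bar> \<le> \<kappa>1 \<Longrightarrow> \<bar>i\<bar> \<le> \<kappa>1 \<Longrightarrow> \<bar>j\<bar> \<le> \<kappa>1 \<Longrightarrow> (t, i, j) \<in> G -` T"
    by (rule open_contains_box[OF GT]) (rule that)
  define \<kappa> where "\<kappa> = min \<kappa>0 \<kappa>1"
  have \<kappa>: "0 < \<kappa>" using \<kappa>0(1) \<kappa>1(1) by (simp add: \<kappa>_def)
  have T0: "G (0, i, j) \<in> T" if "\<bar>i\<bar> \<le> \<kappa>" "\<bar>j\<bar> \<le> \<kappa>" for i j
    using \<kappa>0(2)[of 0 i j] \<kappa>0(1) that by (simp add: \<kappa>_def)
  \<comment> \<open>At the far end a slab of length \<open>\<kappa>\<close>, not just the face, lies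
    in \<open>T\<close>. This keeps the maximum point at least time \<open>\<kappa>\<close> away
    from that end.\<close>
  have T1: "G (t, i, j) \<in> T" if "1 - \<kappa> \<le> t" "t \<le> 1" "\<bar>i\<bar> \<le> \<kappa>" "\<bar>j\<bar> \<le> \<kappa>" for t i j
    using \<kappa>1(2)[of t i j] \<kappa>1(1) that by (simp add: \<kappa>_def)
  define C where "C = G ` ({0..1} \<times> {- \<kappa>..\<kappa>} \<times> {- \<kappa>..\<kappa>})"
  have C_iff: "x \<in> C \<longleftrightarrow> 0 \<le> S x \<and> S x \<le> 1 \<and> \<bar>I x\<bar> \<le> \<kappa> \<and> \<bar>J x\<bar> \<le> \<kappa>" for x
  proof
    assume "x \<in> C"
    then obtain s i j where "x = G (s, i, j)" "s \<in> {0..1}" "i \<in> {- \<kappa>..\<kappa>}" "j \<in> {- \<kappa>..\<kappa>}"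
      unfolding C_def by blast
    then show "0 \<le> S x \<and> S x \<le> 1 \<and> \<bar>I x\<bar> \<le> \<kappa> \<and> \<bar>J x\<bar> \<le> \<kappa>" by (simp add: SG IG JG abs_le_iff)
  next
    assume "0 \<le> S x \<and> S x \<le> 1 \<and> \<bar>I x\<bar> \<le> \<kappa> \<and> \<bar>J x\<bar> \<le> \<kappa>"
    then have "(S x, I x, J x) \<in> {0..1} \<times> {- \<kappa>..\<kappa>} \<times> {- \<kappa>..\<kappa>}" by (simp add: abs_le_iff)
    then have "G (S x, I x, J x) \<in> C" unfolding C_def by (rule imageI)
    then show "x \<in> C" by (simp only: GSIJ)
  qed
  have "compact C" unfolding C_def
    by (intro compact_continuous_image compact_Times compact_Icc continuous_on_subset[OF G(1) subset_UNIV])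
  \<comment> \<open>Every flow line of the tube has both ends in \<open>T\<close>, so h-convexity
    keeps it in \<open>\<Omega>\<close>.\<close>
  have C\<Omega>: "C \<subseteq> \<Omega>"
  proof
    fix x assume x: "x \<in> C"
    then have ij: "\<bar>I x\<bar> \<le> \<kappa>" "\<bar>J x\<bar> \<le> \<kappa>" by (simp_all add: C_iff)
    have "hline (G (0, I x, J x)) v 0 \<in> \<Omega>" "hline (G (0, I x, J x)) v 1 \<in> \<Omega>"
      using T0[OF ij] T1[OF _ _ ij, of 1] \<kappa> by (simp_all add: hG T_def)
    then have "hline (G (0, I x, J x)) v (S x) \<in> \<Omega>"
      by (rule h_convexD[OF \<Omega>(2)]) (use x in \<open>simp_all add: C_iff\<close>)
    then show "x \<in> \<Omega>" by (simp add: hG GSIJ)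
  qed
  define D where "D = {x. 0 < S x} \<inter> {x. S x < 1} \<inter> {x. \<bar>I x\<bar> < \<kappa>} \<inter> {x. \<bar>J x\<bar> < \<kappa>}"
  have "open D" unfolding D_def
    by (intro open_Int open_Collect_less continuous_intros C1_on_imp_continuous_on G)
  have DC: "D \<subseteq> C" by (auto simp: D_def C_iff)
  obtain M where M: "\<forall>x\<in>C. u N x \<le> M"
    using usc_on_bdd_above_compact[OF \<Omega>(1) usc \<open>compact C\<close> C\<Omega>] unfolding bdd_above_def by blast
  \<comment> \<open>Half of the gap: on the segment \<open>\<phi>\<close> is at most
    \<open>\<epsilon>\<close>, so the final bound \<open>\<phi> + c\<close> contradicts the value of
    \<open>U\<close>.\<close>
  define \<epsilon> where "\<epsilon> = (U (hline p v s0) - c) / 2"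
  have \<epsilon>: "0 < \<epsilon>" "\<epsilon> + c < U (hline p v s0)" using c(2) by (simp_all add: \<epsilon>_def field_simps)
  \<comment> \<open>On the lateral faces \<open>\<phi>\<close> is then at least
    \<open>M - c\<close>, so no maximum with value above \<open>c\<close> occurs there.\<close>
  define K where "K = \<bar>M - c\<bar> / \<kappa>\<^sup>2"
  have K: "0 \<le> K" "M - c \<le> K * \<kappa>\<^sup>2" using \<kappa> by (simp_all add: K_def)
  define \<phi> where "\<phi> x = \<epsilon> * S x + K * ((I x)\<^sup>2 + (J x)\<^sup>2)" for x
  have \<phi>: "C1_on UNIV \<phi>" unfolding \<phi>_def
    by (intro C1_on_add C1_on_mult C1_on_power2 C1_on_const G)
  have \<phi>_ge: "K * (I x)\<^sup>2 \<le> \<phi> x" "K * (J x)\<^sup>2 \<le> \<phi> x" if "x \<in> C" for x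
  proof -
    have "0 \<le> \<epsilon> * S x" "0 \<le> K * (I x)\<^sup>2" "0 \<le> K * (J x)\<^sup>2" using that \<epsilon>(1) K(1) by (simp_all add: C_iff)
    then show "K * (I x)\<^sup>2 \<le> \<phi> x" "K * (J x)\<^sup>2 \<le> \<phi> x" by (simp_all add: \<phi>_def distrib_left)
  qed
  have \<phi>_nonneg: "0 \<le> \<phi> x" if "x \<in> C" for x
    using \<phi>_ge(1)[OF that] mult_nonneg_nonneg[OF K(1) zero_le_power2[of "I x"]] by linarith
  have u_mono: "u n x \<le> u m x" if "m \<le> n" "x \<in> \<Omega>" for m n x
    using that(1) by (induction n rule: dec_induct) (auto intro: order_trans dec[OF that(2)])
  have sub_bound: "g x \<le> \<phi> x + max (B - \<epsilon> * \<kappa>) c"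
    if g: "subsolution \<Omega> (u n) g" and n: "N \<le> n" and B: "\<And>x. x \<in> D \<Longrightarrow> u n x \<le> \<phi> x + B" and x: "x \<in> C"
    for g n B x
  proof -
    have gu: "g y \<le> u N y" if "y \<in> \<Omega>" for y
      using subsolution_le[OF \<Omega>(1) g usc that] u_mono[OF n that] by linarith
    have "usc_on \<Omega> (\<lambda>y. g y - \<phi> y)"
      using g unfolding subsolution_def
      by (intro usc_on_diff_continuous continuous_on_subset[OF C1_on_imp_continuous_on[OF \<phi>] subset_UNIV]) blast
    moreover have "C \<noteq> {}" using x by blast
    ultimately obtain w where w: "w \<in> C" "\<And>y. y \<in> C \<Longrightarrow> g y - \<phi> y \<le> g w - \<phi> w"
      using usc_on_attains_max[OF \<Omega>(1) _ \<open>compact C\<close> C\<Omega>] by blast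
    have "g w - \<phi> w \<le> max (B - \<epsilon> * \<kappa>) c"
    proof (cases "g w - \<phi> w \<le> c")
      case False
      have w\<Omega>: "w \<in> \<Omega>" using w(1) C\<Omega> by blast
      have uw: "c + \<phi> w < u N w" using False gu[OF w\<Omega>] by linarith
      have gw: "c < g w" using False \<phi>_nonneg[OF w(1)] by linarith
      \<comment> \<open>Since \<open>u N w\<close> exceeds \<open>c\<close>, the point avoids both
        ends of the tube; the choice of \<open>K\<close> excludes the lateral faces, so
        \<open>w\<close> is interior.\<close>
      have notT: "w \<notin> T" using uw \<phi>_nonneg[OF w(1)] by (simp add: T_def)
      have wC: "0 \<le> S w" "S w \<le> 1" "\<bar>I w\<bar> \<le> \<kappa>" "\<bar>J w\<bar> \<le> \<kappa>" using w(1) by (simp_all add: C_iff)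
      have Sw: "0 < S w" "S w < 1 - \<kappa>"
      proof -
        have "S w \<noteq> 0" using T0[OF wC(3,4)] notT GSIJ[of w] by metis
        then show "0 < S w" using wC(1) by linarith
        show "S w < 1 - \<kappa>" using T1[OF _ wC(2-4)] notT GSIJ[of w] by (metis not_le)
      qed
      have "u N w \<le> M" using M w(1) by blast
      then have "K * \<kappa>\<^sup>2 > \<phi> w" using uw K(2) by linarith
      then have "\<bar>I w\<bar> \<noteq> \<kappa>" "\<bar>J w\<bar> \<noteq> \<kappa>" using \<phi>_ge[OF w(1)]
        by (metis linorder_not_less power2_abs)+
      then have "w \<in> D" using wC Sw \<kappa> by (simp add: D_def)
      then obtain \<rho> where \<rho>: "0 < \<rho>" "ball w \<rho> \<subseteq> D" using \<open>open D\<close> openE by blast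
      have loc: "g y - \<phi> y \<le> g w - \<phi> w" if "y \<in> ball w \<rho>" for y
        using w(2) that \<rho>(2) DC by blast
      have le: "ereal (g w) + hamiltonian \<Omega> g w (hgrad \<phi> w) \<le> ereal (u n w)"
        by (rule subsolution_local_test[OF \<Omega>(1) g w\<Omega> \<rho>(1) C1_on_subset[OF \<phi> subset_UNIV] loc])
      have hline_w: "hline w v t = G (S w + t, I w, J w)" for t
        using hG[of "S w" "I w" "J w" t] by (simp only: GSIJ)
      \<comment> \<open>Along the flow only \<open>S\<close> changes, at unit speed.\<close>
      have grad: "hgrad \<phi> w \<bullet> v = \<epsilon>"
      proof -
        have "\<phi> (hline w v t) = \<epsilon> * (S w + t) + K * ((I w)\<^sup>2 + (J w)\<^sup>2)" for t
          by (simp add: hline_w \<phi>_def SG IG JG)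
        then have "((\<lambda>t. \<phi> (hline w v t)) has_real_derivative \<epsilon>) (at 0)"
          by (auto intro!: derivative_eq_intros)
        then show ?thesis
          using C1_on_has_real_derivative_hline[OF \<phi> UNIV_I] DERIV_unique by blast
      qed
      \<comment> \<open>The end of the flow line through \<open>w\<close> has a value below
        \<open>c\<close>, hence below \<open>g w\<close>, and enters the supremum with
        \<open>(1 - S w) * \<epsilon>\<close>.\<close>
      have \<xi>: "hline w v (1 - S w) \<in> T" using T1[of 1, OF _ _ wC(3,4)] \<kappa> by (simp add: hline_w)
      then have "g (hline w v (1 - S w)) < g w" "hline w v (1 - S w) \<in> \<Omega>"
        using gu[of "hline w v (1 - S w)"] gw by (simp_all add: T_def)
      moreover have "hgrad \<phi> w \<noteq> 0" using grad \<epsilon>(1) by auto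
      ultimately have "ereal ((1 - S w) * \<epsilon>) \<le> hamiltonian \<Omega> g w (hgrad \<phi> w)"
        using hamiltonian_ge[of "hgrad \<phi> w" w v "1 - S w" \<Omega> g] by (simp add: grad)
      then have "ereal (g w) + ereal ((1 - S w) * \<epsilon>) \<le> ereal (u n w)"
        using le add_left_mono order_trans by blast
      then have "g w + (1 - S w) * \<epsilon> \<le> u n w" by simp
      moreover have "\<kappa> * \<epsilon> \<le> (1 - S w) * \<epsilon>" using Sw(2) \<epsilon>(1) by (intro mult_right_mono) simp_all
      moreover have "u n w \<le> \<phi> w + B" by (rule B[OF \<open>w \<in> D\<close>])
      ultimately have "g w - \<phi> w \<le> B - \<epsilon> * \<kappa>" by (simp add: mult.commute)
      then show ?thesis by simp
    qed simp
    then show ?thesis using w(2)[OF x] by linarith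
  qed
  \<comment> \<open>The bound is uniform in the subsolution and continuous on the open set
    \<open>D\<close>, so it passes to the supremum and to its envelope.\<close>
  have u_bound: "u (Suc n) x \<le> \<phi> x + max (B - \<epsilon> * \<kappa>) c"
    if n: "N \<le> n" and B: "\<And>x. x \<in> D \<Longrightarrow> u n x \<le> \<phi> x + B" and x: "x \<in> D" for n B x
  proof -
    let ?h = "\<lambda>x. \<phi> x + max (B - \<epsilon> * \<kappa>) c"
    have "sup_subsolutions \<Omega> (u n) y \<le> ereal (?h y)" if "y \<in> D" for y
      unfolding sup_subsolutions_def using sub_bound[OF _ n B, of _ y] DC that
      by (intro SUP_least) auto
    moreover have "usc_on D ?h"
    proof -
      have "usc_on D (\<lambda>x. max (B - \<epsilon> * \<kappa>) c - (- \<phi> x))"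
        by (intro usc_on_diff_continuous continuous_on_minus
            continuous_on_subset[OF C1_on_imp_continuous_on[OF \<phi>] subset_UNIV]) (simp add: usc_on_def)
      then show ?thesis by (simp add: add.commute)
    qed
    ultimately have "usc_env \<Omega> (sup_subsolutions \<Omega> (u n)) x \<le> ereal (?h x)"
      using \<open>open D\<close> x by (intro usc_env_le[of D ?h])
    moreover have "x \<in> \<Omega>" using x DC C\<Omega> by blast
    ultimately show ?thesis unfolding step[OF \<open>x \<in> \<Omega>\<close>, symmetric] by (simp only: ereal_less_eq(3))
  qed
  have iter: "u (N + k) x \<le> \<phi> x + max (M - real k * (\<epsilon> * \<kappa>)) c" if "x \<in> D" for k x
    using that
  proof (induction k arbitrary: x)
    case 0
    then have "x \<in> C" using DC by blast
    then have "u N x \<le> M" "0 \<le> \<phi> x" using M \<phi>_nonneg by blast+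
    then show ?case by simp
  next
    case (Suc k)
    have "u (Suc (N + k)) x \<le> \<phi> x + max (max (M - real k * (\<epsilon> * \<kappa>)) c - \<epsilon> * \<kappa>) c"
      by (rule u_bound[OF le_add1 Suc.IH Suc.prems])
    \<comment> \<open>Once the bound has reached \<open>c\<close>, a further decrease is absorbed by
      the outer maximum.\<close>
    also have "\<dots> \<le> \<phi> x + max (M - real (Suc k) * (\<epsilon> * \<kappa>)) c"
    proof -
      have "0 \<le> \<epsilon> * \<kappa>" using \<epsilon>(1) \<kappa> by simp
      moreover have "real (Suc k) * (\<epsilon> * \<kappa>) = real k * (\<epsilon> * \<kappa>) + \<epsilon> * \<kappa>" by (simp add: distrib_right)
      ultimately show ?thesis by linarith
    qed
    finally show ?case by simp
  qed
  have "0 < \<epsilon> * \<kappa>" using \<epsilon>(1) \<kappa> by simp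
  then obtain k where "M - c < real k * (\<epsilon> * \<kappa>)" using reals_Archimedean3 by blast
  then have k: "max (M - real k * (\<epsilon> * \<kappa>)) c = c" by simp
  define w where "w = hline p v s0"
  have w: "w = G (s0, 0, 0)" by (simp add: w_def Gp)
  have "w \<in> D" using s0' \<kappa> by (simp add: w D_def SG IG JG)
  then have "u (N + k) w \<le> \<phi> w + c" using iter[of w k] k by simp
  also have "\<phi> w = \<epsilon> * s0" by (simp add: w \<phi>_def SG IG JG)
  also have "\<epsilon> * s0 \<le> \<epsilon>" using s0 \<epsilon>(1) by (simp add: mult_left_le)
  finally have "u (N + k) w \<le> \<epsilon> + c" by simp
  moreover have "w \<in> \<Omega>" using \<open>w \<in> D\<close> DC C\<Omega> by blast
  then have "U w \<le> u (N + k) w"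
    using decseq_ge[OF _ lim] u_mono by (simp add: decseq_def)
  ultimately show False using \<epsilon>(2) by (simp add: w_def)
qed

theorem theorem4p5:
  fixes \<Omega> :: "heis set" and f f_low :: "heis \<Rightarrow> real"
  assumes "open \<Omega>" and "connected \<Omega>" and "h_convex \<Omega>"
    and "usc_on \<Omega> f"
    and "usc_on \<Omega> f_low" and "h_quasiconvex_on \<Omega> f_low"
    and "\<forall>p\<in>\<Omega>. f_low p \<le> f p"
  shows "(locally_bounded_on \<Omega> f_low \<longrightarrow> (\<exists>u. hq_iteration \<Omega> f u)) \<and>
    (\<forall>u. hq_iteration \<Omega> f u \<longrightarrow>
       (\<forall>p\<in>\<Omega>. (\<lambda>n. ereal (u n p)) \<longlonglongrightarrow> hq_envelope \<Omega> f p)) \<and>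
    (\<forall>p\<in>\<Omega>. \<bar>hq_envelope \<Omega> f p\<bar> \<noteq> \<infinity>) \<and> usc_on \<Omega> (hq_envelope \<Omega> f)"
proof -
  have low: "f_low p \<le> f p" if "p \<in> \<Omega>" for p using assms(7) that by blast
  obtain E where E: "\<And>p. p \<in> \<Omega> \<Longrightarrow> hq_envelope \<Omega> f p = ereal (E p)" "usc_on \<Omega> E"
    "h_quasiconvex_on \<Omega> E" "\<And>p. p \<in> \<Omega> \<Longrightarrow> E p \<le> f p"
    and E_max: "\<And>u p. h_quasiconvex_on \<Omega> u \<Longrightarrow> (\<And>q. q \<in> \<Omega> \<Longrightarrow> u q \<le> f q) \<Longrightarrow> p \<in> \<Omega> \<Longrightarrow> u p \<le> E p"
    by (rule hq_envelope_attained[OF assms(1,3,4,6)]) (rule low, assumption, (rule that; blast))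
  have "usc_on \<Omega> (hq_envelope \<Omega> f) \<longleftrightarrow> usc_on \<Omega> (\<lambda>p. ereal (E p))"
    by (rule usc_on_cong) (rule E(1))
  then have usc: "usc_on \<Omega> (hq_envelope \<Omega> f)" using E(2) by (simp only: usc_on_ereal_iff)
  have fin: "\<bar>hq_envelope \<Omega> f p\<bar> \<noteq> \<infinity>" if "p \<in> \<Omega>" for p unfolding E(1)[OF that] by simp
  have ex: "\<exists>u. hq_iteration \<Omega> f u" if "locally_bounded_on \<Omega> f_low"
    by (rule hq_iteration_exists[OF assms(1,4,5,6) that]) (rule low, assumption, rule exI)
  have conv: "(\<lambda>n. ereal (u n p)) \<longlonglongrightarrow> hq_envelope \<Omega> f p" if u: "hq_iteration \<Omega> f u" and p: "p \<in> \<Omega>" for u p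
  proof -
    have u0: "u 0 q = f q" if "q \<in> \<Omega>" for q using u that unfolding hq_iteration_def by blast
    have step: "ereal (u (Suc n) q) = usc_env \<Omega> (sup_subsolutions \<Omega> (u n)) q" if "q \<in> \<Omega>" for n q
      using u that unfolding hq_iteration_def by blast
    have usc_u: "usc_on \<Omega> (u n)" for n
    proof (cases n)
      case 0
      have "usc_on \<Omega> (u 0) \<longleftrightarrow> usc_on \<Omega> f" by (rule usc_on_cong) (rule u0)
      then show ?thesis using 0 assms(4) by simp
    next
      case (Suc m)
      then show ?thesis using u unfolding hq_iteration_def by simp
    qed
    have dec: "u (Suc n) q \<le> u n q" if "q \<in> \<Omega>" for n q
    proof -
      have "usc_env \<Omega> (sup_subsolutions \<Omega> (u n)) q \<le> ereal (u n q)"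
        by (rule usc_env_le[OF assms(1) usc_u that sup_subsolutions_le[OF assms(1) usc_u]])
      then show ?thesis unfolding step[OF that, symmetric] by simp
    qed
    have u_le_f: "u n q \<le> f q" if "q \<in> \<Omega>" for n q
    proof (induction n)
      case (Suc n) then show ?case using dec[OF that, of n] by linarith
    qed (simp add: u0[OF that])
    have E_le: "E q \<le> u n q" if "q \<in> \<Omega>" for n q
      using that
    proof (induction n arbitrary: q)
      case 0 then show ?case using E(4) u0 by simp
    next
      case (Suc n)
      \<comment> \<open>Some subsolution exists because the next iterate is real-valued: with none,
        the supremum would be \<open>- \<infinity>\<close> everywhere and so would its
        envelope.\<close>
      have "{w. subsolution \<Omega> (u n) w} \<noteq> {}"
      proof
        assume "{w. subsolution \<Omega> (u n) w} = {}"
        then have "sup_subsolutions \<Omega> (u n) y \<le> - \<infinity>" for y by (simp add: sup_subsolutions_def bot_ereal_def)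
        then have "usc_env \<Omega> (sup_subsolutions \<Omega> (u n)) q \<le> ereal (u (Suc n) q - 1)"
          by (intro usc_env_le[OF assms(1) _ Suc.prems]) (simp_all add: usc_on_def)
        then show False unfolding step[OF Suc.prems, symmetric] by simp
      qed
      then obtain w where "subsolution \<Omega> (u n) w" by blast
      then have "subsolution \<Omega> (u n) (\<lambda>x. max (w x) (E x))"
        by (intro subsolution_max assms(1) E(2,3) Suc.IH)
      then have "ereal (max (w q) (E q)) \<le> sup_subsolutions \<Omega> (u n) q" by (rule sup_subsolutions_ge)
      also have "\<dots> \<le> ereal (u (Suc n) q)" unfolding step[OF Suc.prems] by (rule usc_env_ge[OF Suc.prems])
      finally have "max (w q) (E q) \<le> u (Suc n) q" by (simp only: ereal_less_eq(3))
      then show ?case by simp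
    qed
    define U where "U q = lim (\<lambda>n. u n q)" for q
    have lim: "(\<lambda>n. u n q) \<longlonglongrightarrow> U q" if q: "q \<in> \<Omega>" for q
    proof -
      have "decseq (\<lambda>n. u n q)" using dec[OF q] by (rule decseq_SucI)
      moreover have "\<forall>n. E q \<le> u n q" using E_le[OF q] by blast
      ultimately obtain L where "(\<lambda>n. u n q) \<longlonglongrightarrow> L" by (rule decseq_convergent)
      then show ?thesis unfolding U_def by (simp only: limI)
    qed
    have "h_quasiconvex_on \<Omega> U"
      by (rule h_quasiconvex_iteration_limit[OF assms(1,3) usc_u step dec lim])
    moreover have "U q \<le> f q" if "q \<in> \<Omega>" for q
      by (rule LIMSEQ_le_const2[OF lim[OF that]]) (use u_le_f[OF that] in blast)
    \<comment> \<open>The limit is itself a competitor in the definition of the envelope.\<close>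
    ultimately have "U p \<le> E p" using p by (rule E_max)
    moreover have "E p \<le> U p"
      by (rule LIMSEQ_le_const[OF lim[OF p]]) (use E_le[OF p] in blast)
    ultimately have "(\<lambda>n. u n p) \<longlonglongrightarrow> E p" using lim[OF p] by simp
    then show ?thesis unfolding E(1)[OF p] by (rule tendsto_ereal)
  qed
  show ?thesis by (intro conjI allI impI ballI ex conv fin usc)
qed

end
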